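(* Let $G=(V,E)$ be a connected directed tree (arbitrary edge orientation) with $N$ vertices and edges $e_1,\dots,e_m$, and let $0<\beta<1$. The stabilizing positive semidefinite solution $H\in\mathbb{R}^{N\times N}$ of the reduced DARE is $$H=q_0\,\mathbf{1}\mathbf{1}^\top+\sum_{a=1}^{h_{\max}}\ \sum_{\Omega\in\mathcal{C}_a}\kappa_{a,\Omega}\,\xi_\Omega\xi_\Omega^\top,\qquad q_0=\frac{1}{(1-\beta)\sum_{v\in V}\beta^{-h(v)}}.$$ Moreover, every vertex set appearing in this formula (that is, $V$ and every $\Omega\in\mathcal{C}_a$ with $1\le a\le h_{\max}$) belongs to $\mathcal{L}$, the matrix $H$ belongs to $\mathcal{V}_{\mathcal{L}}$, and every coefficient ($q_0$ and all $\kappa_{a,\Omega}$) in the formula is positive.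
   Context: A connected directed tree is a finite directed graph whose underlying undirected graph is a tree; the orientation of the edges is arbitrary. $|V|=N$, $|E|=m$, and edge $e_i$ is directed from its sender $s_i$ to its receiver $t_i$, written $e_i:s_i\to t_i$. Let $\hat e_v\in\mathbb{R}^N$ be the standard basis vector at vertex $v$ and $\mathbf 1$ the all-ones vector. The matrices $S,R\in\mathbb{R}^{N\times m}$ have $i$th columns $\hat e_{s_i}$ and $\hat e_{t_i}$ respectively, and $C=R-S$. Put $r=\sqrt\beta$. Reduced DARE: for symmetric $H\in\mathbb{R}^{N\times N}$ put $D=S^\top S+\beta C^\top HC$ and $N_H=-S+\beta HC$. The reduced DARE is the equation $$H=I+\beta H-N_HD^{-1}N_H^\top ,$$ with $D$ required to be nonsingular. A solution $H$ is called stabilizing if every eigenvalue of $r(I-CD^{-1}N_H^\top)$ lies in the open unit disk. (The reduced DARE has exactly one stabilizing positive semidefinite solution.) Height: $h:V\to\mathbb{Z}_{\ge0}$ is the unique function with $h(t_i)=h(s_i)+1$ for every edge $e_i:s_i\to t_i$ and $\min_{v\in V}h(v)=0$; $h_{\max}=\max_v h(v)$. For $a\in\mathbb{Z}$, $V_a=\{v\in V:h(v)\ge a\}$, and $\mathcal{C}_a$ is the collection of (vertex sets of) connected components of the induced subgraph $G[V_a]$ with edge orientations ignored. For $a\le h_{\max}$ and $\Omega\in\mathcal{C}_a$, $\kappa_{a,\Omega}=\left(\sum_{v\in\Omega}\beta^{a-h(v)}\right)^{-1}$. For $\Omega\subseteq V$, $\xi_\Omega\in\mathbb{R}^N$ is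 the indicator vector of $\Omega$. The family $\mathcal{L}$: let $V_{\rm rec}$ be the set of vertices that receive at least one edge. For $v\in V_{\rm rec}$, delete from the underlying undirected tree all edges entering $v$, and let $\mathcal{R}(v)\subseteq V$ be the vertex set of the resulting connected component containing $v$. Then $$\mathcal{L}=\{V\}\cup\Big\{\bigcap_{v\in J}\mathcal{R}(v):\ \emptyset\ne J\subseteq V_{\rm rec},\ \bigcap_{v\in J}\mathcal{R}(v)\ne\emptyset\Big\},\qquad \mathcal{V}_{\mathcal L}=\operatorname{span}\{\xi_\Omega\xi_\Omega^\top:\Omega\in\mathcal{L}\}.$$ *)

theory Defs
  imports
    Graph_Theory.Digraph_Component
    Jordan_Normal_Form.VS_Connect
    Jordan_Normal_Form.Char_Poly
    Jordan_Normal_Form.Gauss_Jordan_Elimination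
    "HOL-Library.FuncSet"
begin

section \<open>Directed trees\<close>

text \<open>
  Each edge becomes two arcs, one per direction of traversal, that remember the
  edge they come from.
\<close>

definition traversals :: "('a, 'b) pre_digraph \<Rightarrow> ('a, 'b \<times> bool) pre_digraph" where
  "traversals G = \<lparr> verts = verts G, arcs = arcs G \<times> UNIV,
     tail = (\<lambda>(e, fwd). if fwd then tail G e else head G e),
     head = (\<lambda>(e, fwd). if fwd then head G e else tail G e) \<rparr>"

text \<open>
  A cycle of the underlying undirected multigraph is a cycle that uses no edge
  twice; loops and pairs of parallel or antiparallel edges count as cycles.
  The library's predicate \<open>tree\<close> forbids only directed cycles and is therefore not
  the right notion here.
\<close>

definition undirected_cycle :: "('a, 'b) pre_digraph \<Rightarrow> ('b \<times> bool) list \<Rightarrow> bool" where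
  "undirected_cycle G p \<longleftrightarrow> pre_digraph.cycle (traversals G) p \<and> distinct (map fst p)"

definition directed_tree :: "('a, 'b) pre_digraph \<Rightarrow> bool" where
  "directed_tree G \<longleftrightarrow> fin_digraph G \<and> Digraph_Component.connected G
     \<and> \<not> (\<exists>p. undirected_cycle G p)"

definition undirected_components :: "('a, 'b) pre_digraph \<Rightarrow> 'a set set" where
  "undirected_components G = pre_digraph.sccs_verts (with_proj (mk_symmetric G))"

definition undirected_component_of :: "('a, 'b) pre_digraph \<Rightarrow> 'a \<Rightarrow> 'a set" where
  "undirected_component_of G v = pre_digraph.scc_of (with_proj (mk_symmetric G)) v"


section \<open>Height and superlevel components\<close>

text \<open>Extensionality outside the vertex set is needed for uniqueness.\<close>

definition height :: "('a, 'b) pre_digraph \<Rightarrow> 'a \<Rightarrow> int" where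
  "height G = (THE h. h \<in> verts G \<rightarrow>\<^sub>E {0..}
     \<and> (\<forall>e\<in>arcs G. h (head G e) = h (tail G e) + 1)
     \<and> Min (h ` verts G) = 0)"

definition height_max :: "('a, 'b) pre_digraph \<Rightarrow> int" where
  "height_max G = Max (height G ` verts G)"

definition superlevel :: "('a, 'b) pre_digraph \<Rightarrow> int \<Rightarrow> 'a set" where
  "superlevel G a = {v \<in> verts G. height G v \<ge> a}"

definition superlevel_components :: "('a, 'b) pre_digraph \<Rightarrow> int \<Rightarrow> 'a set set" where
  "superlevel_components G a = undirected_components (G \<restriction> superlevel G a)"

definition kappa :: "('a, 'b) pre_digraph \<Rightarrow> real \<Rightarrow> int \<Rightarrow> 'a set \<Rightarrow> real" where
  "kappa G \<beta> a \<Omega> = inverse (\<Sum>v\<in>\<Omega>. \<beta> powi (a - height G v))"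

definition q0 :: "('a, 'b) pre_digraph \<Rightarrow> real \<Rightarrow> real" where
  "q0 G \<beta> = 1 / ((1 - \<beta>) * (\<Sum>v\<in>verts G. \<beta> powi (- height G v)))"


section \<open>The family \<open>\<L>\<close> and its span\<close>

definition receivers :: "('a, 'b) pre_digraph \<Rightarrow> 'a set" where
  "receivers G = head G ` arcs G"

definition receiver_region :: "('a, 'b) pre_digraph \<Rightarrow> 'a \<Rightarrow> 'a set" where
  "receiver_region G v = undirected_component_of (G\<lparr>arcs := arcs G - in_arcs G v\<rparr>) v"

definition family_L :: "('a, 'b) pre_digraph \<Rightarrow> 'a set set" where
  "family_L G = {verts G} \<union>
     {\<Inter>v\<in>J. receiver_region G v | J. J \<noteq> {} \<and> J \<subseteq> receivers G
        \<and> (\<Inter>v\<in>J. receiver_region G v) \<noteq> {}}"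

definition ones_vec :: "nat \<Rightarrow> real vec" where
  "ones_vec n = vec n (\<lambda>_. 1)"

definition indicator_vec :: "nat \<Rightarrow> nat set \<Rightarrow> real vec" where
  "indicator_vec n \<Omega> = vec n (\<lambda>v. if v \<in> \<Omega> then 1 else 0)"

definition self_outer :: "real vec \<Rightarrow> real mat" where
  "self_outer x = mat (dim_vec x) (dim_vec x) (\<lambda>(i, j). x $ i * x $ j)"

abbreviation real_mats :: "nat \<Rightarrow> (real, real mat) module" where
  "real_mats n \<equiv> module_mat TYPE(real) n n"

definition space_VL :: "(nat, 'b) pre_digraph \<Rightarrow> real mat set" where
  "space_VL G = (let N = card (verts G) in
     LinearCombinations.module.span class_ring (real_mats N)
       ((\<lambda>\<Omega>. self_outer (indicator_vec N \<Omega>)) ` family_L G))"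


section \<open>The reduced DARE\<close>

text \<open>
  The matrices below are meant for graphs with vertex set \<open>{..<N}\<close> and edge set \<open>{..<m}\<close>.
\<close>

definition sender_mat :: "(nat, nat) pre_digraph \<Rightarrow> real mat" where
  "sender_mat G = (let N = card (verts G) in
     mat_of_cols N (map (\<lambda>i. unit_vec N (tail G i)) [0..<card (arcs G)]))"

definition receiver_mat :: "(nat, nat) pre_digraph \<Rightarrow> real mat" where
  "receiver_mat G = (let N = card (verts G) in
     mat_of_cols N (map (\<lambda>i. unit_vec N (head G i)) [0..<card (arcs G)]))"

definition C_mat :: "(nat, nat) pre_digraph \<Rightarrow> real mat" where
  "C_mat G = receiver_mat G - sender_mat G"

definition D_mat :: "(nat, nat) pre_digraph \<Rightarrow> real \<Rightarrow> real mat \<Rightarrow> real mat" where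
  "D_mat G \<beta> H = transpose_mat (sender_mat G) * sender_mat G
     + \<beta> \<cdot>\<^sub>m (transpose_mat (C_mat G) * H * C_mat G)"

definition N_mat :: "(nat, nat) pre_digraph \<Rightarrow> real \<Rightarrow> real mat \<Rightarrow> real mat" where
  "N_mat G \<beta> H = - sender_mat G + \<beta> \<cdot>\<^sub>m (H * C_mat G)"

text \<open>Meaningful only for nonsingular matrices.\<close>

definition inv_mat :: "real mat \<Rightarrow> real mat" where
  "inv_mat A = the (mat_inverse A)"

definition reduced_dare_solution :: "(nat, nat) pre_digraph \<Rightarrow> real \<Rightarrow> real mat \<Rightarrow> bool" where
  "reduced_dare_solution G \<beta> H \<longleftrightarrow> (let N = card (verts G) in
     H \<in> carrier_mat N N \<and> transpose_mat H = H \<and> invertible_mat (D_mat G \<beta> H)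
     \<and> H = 1\<^sub>m N + \<beta> \<cdot>\<^sub>m H
           - N_mat G \<beta> H * inv_mat (D_mat G \<beta> H) * transpose_mat (N_mat G \<beta> H))"

definition closed_loop_mat :: "(nat, nat) pre_digraph \<Rightarrow> real \<Rightarrow> real mat \<Rightarrow> real mat" where
  "closed_loop_mat G \<beta> H = sqrt \<beta> \<cdot>\<^sub>m (1\<^sub>m (card (verts G))
     - C_mat G * inv_mat (D_mat G \<beta> H) * transpose_mat (N_mat G \<beta> H))"

definition stabilizing :: "(nat, nat) pre_digraph \<Rightarrow> real \<Rightarrow> real mat \<Rightarrow> bool" where
  "stabilizing G \<beta> H \<longleftrightarrow>
     (\<forall>z. eigenvalue (map_mat complex_of_real (closed_loop_mat G \<beta> H)) z \<longrightarrow> cmod z < 1)"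

definition psd_mat :: "real mat \<Rightarrow> bool" where
  "psd_mat A \<longleftrightarrow> square_mat A \<and> transpose_mat A = A
     \<and> (\<forall>x\<in>carrier_vec (dim_row A). 0 \<le> x \<bullet> (A *\<^sub>v x))"

definition stabilizing_psd_solution :: "(nat, nat) pre_digraph \<Rightarrow> real \<Rightarrow> real mat \<Rightarrow> bool" where
  "stabilizing_psd_solution G \<beta> H \<longleftrightarrow>
     reduced_dare_solution G \<beta> H \<and> stabilizing G \<beta> H \<and> psd_mat H"

end

theory Submission
  imports Defs "Jordan_Normal_Form.Spectral_Radius"
begin

text \<open>
  The reduced DARE is the Bellman equation of a shipping problem.  A state \<open>x\<close> distributes mass over
  the vertices, a flow \<open>u\<close> moves mass along the edges, the residual \<open>y = x - S u\<close> left at the senders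
  costs \<open>\<parallel>y\<parallel>\<^sup>2\<close>, and the next state \<open>z = x + C u\<close> is discounted by \<open>\<beta>\<close>.  The claimed matrix charges
  \<open>q\<^sub>0\<close> for the squared total mass and \<open>\<kappa>\<^bsub>a,\<Omega>\<^esub>\<close> for the squared mass of each superlevel component.
  This cost decouples by height: an edge from height \<open>a\<close> to height \<open>a + 1\<close> changes only the residual
  of its sender and the mass of the one component of level \<open>a + 1\<close> that it enters.  So the derivative
  of the total cost along the edge vanishes iff the residual equals the discounted price
  \<open>\<beta> \<kappa> z(\<Omega>)\<close> of that component.  These prices are then constant on every component of level
  \<open>a\<close>, and conservation of mass makes the common value \<open>\<kappa>\<^bsub>a,\<Omega>\<^esub> x(\<Omega>)\<close> (\<open>component_price\<close>); the
  weights \<open>\<kappa>\<close> are exactly the ones for which this recursion closes.  Summing the prices along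
  the nested components of a vertex telescopes to the Bellman equation (\<open>bellman_equation\<close>).

  The tree enters through the bridge property of its edges (\<open>tail_notin_component_of_head\<close>).  It
  gives the height function (an edge is crossed by no cut other than its own), the uniqueness of a
  flow with given node balances (\<open>flow_zero_of_balances_zero\<close>), from which \<open>D\<close> is nonsingular, and the
  membership of the components in \<open>\<L>\<close> (\<open>level_component_in_family_L\<close>): a component is cut out by the
  bridges that enter it.

  The closed loop conserves total mass and otherwise passes masses from a component to those one
  level up, so before scaling by \<open>\<surd>\<beta>\<close> its only possible eigenvalues are \<open>0\<close> and \<open>1\<close>
  (\<open>state_zero\<close>), and the solution is stabilizing.  Any two stabilizing solutions satisfy a
  Stein equation \<open>X = A\<^sup>T X B\<close> for their difference, with the two closed loops as coefficients; since the
  powers of both decay, they coincide (\<open>stabilizing_solution_unique\<close>).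
\<close>


section \<open>Undirected components\<close>

context wf_digraph
begin

lemma sym_digraph_mk_symmetric: "sym_digraph (with_proj (mk_symmetric G))"
proof -
  interpret S: pair_wf_digraph "mk_symmetric G" ..
  show ?thesis
    by (rule S.sym_digraphI) (rule symmetric_mk_symmetric)
qed

lemma undirected_component_of_eq_reachable:
  "undirected_component_of G v = {w. v \<rightarrow>\<^sup>*\<^bsub>with_proj (mk_symmetric G)\<^esub> w}"
proof -
  interpret S: sym_digraph "with_proj (mk_symmetric G)"
    by (rule sym_digraph_mk_symmetric)
  show ?thesis
    unfolding undirected_component_of_def S.scc_of_def
    using symmetric_reachable[OF S.sym_arcs] by blast
qed

lemma undirected_component_self: "v \<in> verts G \<Longrightarrow> v \<in> undirected_component_of G v"
proof -
  interpret S: sym_digraph "with_proj (mk_symmetric G)"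
    by (rule sym_digraph_mk_symmetric)
  assume "v \<in> verts G"
  then show ?thesis
    by (auto simp: undirected_component_of_eq_reachable)
qed

lemma undirected_component_subset: "undirected_component_of G v \<subseteq> verts G"
  by (auto simp: undirected_component_of_eq_reachable elim: reachable_in_vertsE)

lemma undirected_component_eq:
  "w \<in> undirected_component_of G v \<Longrightarrow> undirected_component_of G w = undirected_component_of G v"
proof -
  interpret S: sym_digraph "with_proj (mk_symmetric G)"
    by (rule sym_digraph_mk_symmetric)
  show "w \<in> undirected_component_of G v \<Longrightarrow> ?thesis"
    unfolding undirected_component_of_def by (rule S.scc_of_eq)
qed

lemma undirected_component_arc:
  assumes e: "e \<in> arcs G"
  shows "tail G e \<in> undirected_component_of G v \<longleftrightarrow> head G e \<in> undirected_component_of G v"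
proof -
  interpret S: sym_digraph "with_proj (mk_symmetric G)"
    by (rule sym_digraph_mk_symmetric)
  have "tail G e \<rightarrow>\<^bsub>with_proj (mk_symmetric G)\<^esub> head G e"
    and "head G e \<rightarrow>\<^bsub>with_proj (mk_symmetric G)\<^esub> tail G e"
    using e by (auto simp: parcs_mk_symmetric)
  then show ?thesis
    unfolding undirected_component_of_eq_reachable
    using S.reachable_adj_trans by blast
qed

text \<open>
  This closure principle replaces induction along undirected walks; walks themselves occur only in
  the proof that a tree edge is a bridge.
\<close>

lemma undirected_component_least:
  assumes w: "w \<in> undirected_component_of G v" and v: "v \<in> X"
    and closed: "\<And>e. e \<in> arcs G \<Longrightarrow> tail G e \<in> X \<longleftrightarrow> head G e \<in> X"
  shows "w \<in> X"
proof -
  interpret S: sym_digraph "with_proj (mk_symmetric G)"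
    by (rule sym_digraph_mk_symmetric)
  have "v \<rightarrow>\<^sup>*\<^bsub>with_proj (mk_symmetric G)\<^esub> w"
    using w by (simp add: undirected_component_of_eq_reachable)
  then show ?thesis
  proof (induct rule: S.reachable_induct)
    case base
    show ?case by (rule v)
  next
    case (step x y)
    from step(2) obtain e where "e \<in> arcs G"
      "x = tail G e \<and> y = head G e \<or> x = head G e \<and> y = tail G e"
      by (auto simp: parcs_mk_symmetric)
    with step(3) closed show ?case by blast
  qed
qed

lemma undirected_components_eq_image:
  "undirected_components G = undirected_component_of G ` verts G"
proof -
  interpret S: sym_digraph "with_proj (mk_symmetric G)"
    by (rule sym_digraph_mk_symmetric)
  show ?thesis
    unfolding undirected_components_def undirected_component_of_def S.sccs_verts_conv_scc_of
    by simp
qed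

lemma connected_closed_set:
  assumes conn: "Digraph_Component.connected G"
    and closed: "\<And>e. e \<in> arcs G \<Longrightarrow> tail G e \<in> X \<longleftrightarrow> head G e \<in> X"
    and v: "v \<in> verts G" "v \<in> X" and w: "w \<in> verts G"
  shows "w \<in> X"
proof (rule undirected_component_least[OF _ v(2) closed])
  show "w \<in> undirected_component_of G v"
    using conn v w
    by (auto simp: connected_def strongly_connected_def undirected_component_of_eq_reachable)
qed

section \<open>Edges of a tree are bridges\<close>

lemma wf_digraph_traversals: "wf_digraph (traversals G)"
  by unfold_locales (auto simp: traversals_def split: if_splits)

lemma component_imp_reachable_traversals:
  assumes v: "v \<in> verts G" and w: "w \<in> undirected_component_of G v"
  shows "v \<rightarrow>\<^sup>*\<^bsub>traversals G\<^esub> w"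
proof -
  interpret T: wf_digraph "traversals G"
    by (rule wf_digraph_traversals)
  have vert: "verts (traversals G) = verts G"
    by (simp add: traversals_def)
  have "w \<in> {x. v \<rightarrow>\<^sup>*\<^bsub>traversals G\<^esub> x}"
  proof (rule undirected_component_least[OF w])
    show "v \<in> {x. v \<rightarrow>\<^sup>*\<^bsub>traversals G\<^esub> x}"
      using v vert by auto
  next
    fix e assume e: "e \<in> arcs G"
    have "(tail G e, head G e) = arc_to_ends (traversals G) (e, True)"
      "(head G e, tail G e) = arc_to_ends (traversals G) (e, False)"
      "(e, True) \<in> arcs (traversals G)" "(e, False) \<in> arcs (traversals G)"
      using e by (auto simp: traversals_def arc_to_ends_def)
    then have "tail G e \<rightarrow>\<^bsub>traversals G\<^esub> head G e" "head G e \<rightarrow>\<^bsub>traversals G\<^esub> tail G e"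
      using T.dominatesI by metis+
    then show "tail G e \<in> {x. v \<rightarrow>\<^sup>*\<^bsub>traversals G\<^esub> x} \<longleftrightarrow> head G e \<in> {x. v \<rightarrow>\<^sup>*\<^bsub>traversals G\<^esub> x}"
      using T.reachable_adj_trans by blast
  qed
  then show ?thesis by simp
qed

end

lemma traversals_ends:
  "tail (traversals G) (e, b) = (if b then tail G e else head G e)"
  "head (traversals G) (e, b) = (if b then head G e else tail G e)"
  by (simp_all add: traversals_def)

text \<open>
  Traversing an edge a second time, in either direction, revisits the vertex at which the first
  traversal started.
\<close>

lemma distinct_edges_of_path:
  assumes "pre_digraph.cas (traversals G) u p v"
    and "distinct (pre_digraph.awalk_verts (traversals G) u p)"
  shows "distinct (map fst p)"
  using assms
proof (induction p arbitrary: u)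
  case Nil
  then show ?case by simp
next
  case (Cons a p)
  obtain e b where a: "a = (e, b)" by (cases a)
  let ?T = "traversals G"
  have ends: "tail ?T f \<in> set (pre_digraph.awalk_verts ?T x p)
      \<and> head ?T f \<in> set (pre_digraph.awalk_verts ?T x p)"
    if "f \<in> set p" "pre_digraph.cas ?T x p v" for f x
    using that
  proof (induction p arbitrary: x)
    case Nil
    then show ?case by simp
  next
    case (Cons g q)
    then show ?case
      by (cases q) (auto simp: pre_digraph.awalk_verts.simps pre_digraph.cas.simps)
  qed
  have dist: "tail ?T a \<notin> set (pre_digraph.awalk_verts ?T (head ?T a) p)"
    and dist': "distinct (pre_digraph.awalk_verts ?T (head ?T a) p)"
    and cas: "pre_digraph.cas ?T (head ?T a) p v"
    using Cons.prems by (auto simp: pre_digraph.awalk_verts.simps pre_digraph.cas.simps)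
  have "e \<notin> fst ` set p"
  proof
    assume "e \<in> fst ` set p"
    then obtain c where "(e, c) \<in> set p" by auto
    from ends[OF this cas] have "tail ?T a \<in> set (pre_digraph.awalk_verts ?T (head ?T a) p)"
      by (auto simp: a traversals_ends split: if_splits)
    with dist show False by simp
  qed
  with Cons.IH[OF cas dist'] show ?case by (simp add: a)
qed

text \<open>
  If deleting \<open>e\<close> left its ends connected, a path between them would close up with \<open>e\<close> to an
  undirected cycle.
\<close>

lemma tail_notin_component_of_head:
  assumes tree: "directed_tree G" and e: "e \<in> arcs G"
  shows "tail G e \<notin> undirected_component_of (G\<lparr>arcs := arcs G - {e}\<rparr>) (head G e)"
proof
  let ?K = "G\<lparr>arcs := arcs G - {e}\<rparr>"
  let ?T = "traversals G"
  let ?U = "traversals ?K"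
  assume tl: "tail G e \<in> undirected_component_of ?K (head G e)"
  interpret fin_digraph G using tree by (simp add: directed_tree_def)
  interpret K: wf_digraph ?K by unfold_locales auto
  interpret T: wf_digraph ?T by (rule wf_digraph_traversals)
  interpret U: wf_digraph ?U by (rule K.wf_digraph_traversals)
  have "head G e \<rightarrow>\<^sup>*\<^bsub>?U\<^esub> tail G e"
    using K.component_imp_reachable_traversals[OF _ tl] e by simp
  then obtain p where p: "U.apath (head G e) p (tail G e)"
    using U.reachable_apath by blast
  have tails: "tail ?U = tail ?T" "head ?U = head ?T"
    by (auto simp: traversals_def)
  have cas_eq: "U.cas x q y = T.cas x q y" for x q y
    by (induction q arbitrary: x) (auto simp: tails)
  have verts_eq: "U.awalk_verts x q = T.awalk_verts x q" for x q
    by (induction q arbitrary: x) (auto simp: tails)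
  have arcs_U: "arcs ?U = (arcs G - {e}) \<times> UNIV"
    by (simp add: traversals_def)
  have cas: "T.cas (head G e) p (tail G e)" and dist: "distinct (T.awalk_verts (head G e) p)"
    and arcs: "set p \<subseteq> (arcs G - {e}) \<times> UNIV"
    using p arcs_U unfolding U.apath_def U.awalk_def cas_eq verts_eq by auto
  let ?c = "(e, True) # p"
  have "T.awalk (tail G e) ?c (tail G e)"
    using cas arcs e unfolding T.awalk_def
    by (auto simp: traversals_ends) (auto simp: traversals_def)
  moreover have "distinct (tl (T.awalk_verts (tail G e) ?c))"
    using dist by (simp add: traversals_ends)
  ultimately have "T.cycle ?c"
    unfolding T.cycle_def by blast
  moreover have "distinct (map fst ?c)"
    using distinct_edges_of_path[OF cas dist] arcs by auto
  ultimately have "undirected_cycle G ?c"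
    by (simp add: undirected_cycle_def)
  with tree show False
    unfolding directed_tree_def by blast
qed

section \<open>Bridges and the height function\<close>

locale oriented_tree = fin_digraph +
  assumes directed_tree: "directed_tree G"
begin

lemma tree_connected: "Digraph_Component.connected G"
  using directed_tree by (simp add: directed_tree_def)

lemma verts_nonempty: "verts G \<noteq> {}"
  using tree_connected by (simp add: connected_def strongly_connected_def)

definition head_side :: "'b \<Rightarrow> 'a set" where
  "head_side e = undirected_component_of (G\<lparr>arcs := arcs G - {e}\<rparr>) (head G e)"

lemma head_in_head_side: "e \<in> arcs G \<Longrightarrow> head G e \<in> head_side e"
  and head_side_arc:
    "f \<in> arcs G \<Longrightarrow> f \<noteq> e \<Longrightarrow> tail G f \<in> head_side e \<longleftrightarrow> head G f \<in> head_side e"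
proof -
  interpret K: wf_digraph "G\<lparr>arcs := arcs G - {e}\<rparr>" by unfold_locales auto
  show "e \<in> arcs G \<Longrightarrow> head G e \<in> head_side e"
    unfolding head_side_def by (rule K.undirected_component_self) simp
  show "f \<in> arcs G \<Longrightarrow> f \<noteq> e \<Longrightarrow> tail G f \<in> head_side e \<longleftrightarrow> head G f \<in> head_side e"
    unfolding head_side_def using K.undirected_component_arc[of f] by simp
qed

lemma tail_notin_head_side: "e \<in> arcs G \<Longrightarrow> tail G e \<notin> head_side e"
  unfolding head_side_def by (rule tail_notin_component_of_head[OF directed_tree])

lemma head_side_subset: "head_side e \<subseteq> verts G"
proof -
  interpret K: wf_digraph "G\<lparr>arcs := arcs G - {e}\<rparr>" by unfold_locales auto
  show ?thesis
    using K.undirected_component_subset by (simp add: head_side_def)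
qed

definition is_height :: "('a \<Rightarrow> int) \<Rightarrow> bool" where
  "is_height h \<longleftrightarrow> h \<in> verts G \<rightarrow>\<^sub>E {0..}
     \<and> (\<forall>e\<in>arcs G. h (head G e) = h (tail G e) + 1) \<and> Min (h ` verts G) = 0"

lemma is_height_unique:
  assumes h: "is_height h" and k: "is_height k"
  shows "h = k"
proof
  have conn: "h w - k w = h v - k v" if "v \<in> verts G" "w \<in> verts G" for v w
    using connected_closed_set[OF tree_connected, of "{x. h x - k x = h v - k v}" v w] h k that
    by (auto simp: is_height_def)
  have le: "g w \<ge> 0" "\<exists>v\<in>verts G. g v = 0" if "is_height g" "w \<in> verts G" for g w
  proof -
    show "g w \<ge> 0" using that by (auto simp: is_height_def)
    have "Min (g ` verts G) \<in> g ` verts G"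
      by (rule Min_in) (use verts_nonempty in auto)
    then show "\<exists>v\<in>verts G. g v = 0" using that by (auto simp: is_height_def)
  qed
  fix v
  show "h v = k v"
  proof (cases "v \<in> verts G")
    case True
    obtain x y where "x \<in> verts G" "h x = 0" "y \<in> verts G" "k y = 0"
      using le(2)[OF h True] le(2)[OF k True] by blast
    then show ?thesis
      using conn[OF True, of x] conn[OF True, of y] le(1)[OF h, of y] le(1)[OF k, of x] by simp
  next
    case False
    then show ?thesis using h k by (auto simp: is_height_def PiE_def extensional_def)
  qed
qed

text \<open>
  Counting the bridges whose head side contains \<open>v\<close> gives a height function up to a constant: the
  two ends of an edge lie on the same side of every other bridge.
\<close>

lemma is_height_exists: "\<exists>h. is_height h"
proof -
  define k where "k v = int (card {e \<in> arcs G. v \<in> head_side e})" for v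
  define c where "c = Min (k ` verts G)"
  define h where "h = restrict (\<lambda>v. k v - c) (verts G)"
  have step: "k (head G e) = k (tail G e) + 1" if e: "e \<in> arcs G" for e
  proof -
    have "{f \<in> arcs G. head G e \<in> head_side f} = insert e {f \<in> arcs G. tail G e \<in> head_side f}"
    proof (rule Set.set_eqI)
      fix f
      show "f \<in> {f \<in> arcs G. head G e \<in> head_side f}
          \<longleftrightarrow> f \<in> insert e {f \<in> arcs G. tail G e \<in> head_side f}"
        by (cases "f = e") (use e head_in_head_side head_side_arc[OF e] in auto)
    qed
    then show ?thesis
      using tail_notin_head_side[OF e] by (simp add: k_def)
  qed
  have "c \<in> k ` verts G"
    unfolding c_def by (rule Min_in) (use verts_nonempty in auto)
  then obtain r where r: "r \<in> verts G" "k r = c" by auto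
  have c_le: "c \<le> k v" if "v \<in> verts G" for v
    unfolding c_def using that by simp
  have "Min (h ` verts G) = 0"
  proof (rule Min_eqI)
    show "0 \<in> h ` verts G" using r by (auto simp: h_def image_iff intro!: bexI[of _ r])
    show "\<And>y. y \<in> h ` verts G \<Longrightarrow> 0 \<le> y" using c_le by (auto simp: h_def)
  qed simp
  then have "is_height h"
    unfolding is_height_def using step c_le by (auto simp: h_def)
  then show ?thesis by blast
qed

lemma is_height_height: "is_height (height G)"
proof -
  have "height G = (THE h. is_height h)"
    by (simp add: height_def is_height_def)
  then show ?thesis
    using theI'[of is_height] is_height_exists is_height_unique by auto
qed

lemma height_head: "e \<in> arcs G \<Longrightarrow> height G (head G e) = height G (tail G e) + 1"
  and height_nonneg: "v \<in> verts G \<Longrightarrow> 0 \<le> height G v"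
  using is_height_height by (auto simp: is_height_def)

lemma height_zero_exists: "\<exists>v\<in>verts G. height G v = 0"
proof -
  have "Min (height G ` verts G) \<in> height G ` verts G"
    by (rule Min_in) (use verts_nonempty in auto)
  then show ?thesis using is_height_height by (auto simp: is_height_def)
qed

lemma height_le_max: "v \<in> verts G \<Longrightarrow> height G v \<le> height_max G"
  by (simp add: height_max_def)

section \<open>Components of the superlevel sets\<close>

definition level_component :: "int \<Rightarrow> 'a \<Rightarrow> 'a set" where
  "level_component a v = undirected_component_of (G \<restriction> superlevel G a) v"

lemma wf_digraph_superlevel: "wf_digraph (G \<restriction> superlevel G a)"
  by unfold_locales auto

lemma superlevel_subset: "superlevel G a \<subseteq> verts G"
  by (auto simp: superlevel_def)

lemma superlevel_components_eq: "superlevel_components G a = level_component a ` superlevel G a"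
  unfolding superlevel_components_def level_component_def
  using wf_digraph.undirected_components_eq_image[OF wf_digraph_superlevel] by simp

lemma level_component_self: "v \<in> superlevel G a \<Longrightarrow> v \<in> level_component a v"
  unfolding level_component_def
  using wf_digraph.undirected_component_self[OF wf_digraph_superlevel, of v a] by simp

lemma level_component_subset: "level_component a v \<subseteq> superlevel G a"
  unfolding level_component_def
  using wf_digraph.undirected_component_subset[OF wf_digraph_superlevel, of a v] by simp

lemma finite_level_component: "finite (level_component a v)"
  using level_component_subset superlevel_subset finite_verts finite_subset by metis

lemma level_component_eq:
  "w \<in> level_component a v \<Longrightarrow> level_component a w = level_component a v"
  unfolding level_component_def
  using wf_digraph.undirected_component_eq[OF wf_digraph_superlevel] .

lemma arc_in_superlevel:
  "e \<in> arcs G \<Longrightarrow> a \<le> height G (tail G e) \<Longrightarrow> e \<in> arcs (G \<restriction> superlevel G a)"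
  using height_head[of e] by (auto simp: superlevel_def)

lemma level_component_arc_iff:
  assumes "e \<in> arcs G" "a \<le> height G (tail G e)"
  shows "tail G e \<in> level_component a v \<longleftrightarrow> head G e \<in> level_component a v"
  unfolding level_component_def
  using wf_digraph.undirected_component_arc[OF wf_digraph_superlevel arc_in_superlevel[OF assms]]
  by simp

lemma level_component_arc:
  assumes "e \<in> arcs G" "a \<le> height G (tail G e)"
  shows "level_component a (head G e) = level_component a (tail G e)"
proof (rule level_component_eq)
  have "tail G e \<in> superlevel G a"
    using assms by (auto simp: superlevel_def)
  then show "head G e \<in> level_component a (tail G e)"
    using level_component_arc_iff[OF assms, of "tail G e"] level_component_self[of "tail G e" a]
    by simp
qed

lemma level_component_least:
  assumes "w \<in> level_component a v" "v \<in> X"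
    and "\<And>e. e \<in> arcs G \<Longrightarrow> a \<le> height G (tail G e) \<Longrightarrow> tail G e \<in> X \<longleftrightarrow> head G e \<in> X"
  shows "w \<in> X"
proof (rule wf_digraph.undirected_component_least[OF wf_digraph_superlevel])
  show "w \<in> undirected_component_of (G \<restriction> superlevel G a) v"
    using assms(1) by (simp add: level_component_def)
qed (use assms in \<open>auto simp: superlevel_def\<close>)

lemma constant_on_level_component:
  assumes "w \<in> level_component a v"
    and "\<And>e. e \<in> arcs G \<Longrightarrow> a \<le> height G (tail G e) \<Longrightarrow> f (tail G e) = f (head G e)"
  shows "f w = f v"
  using level_component_least[OF assms(1), of "{x. f x = f v}"] assms(2) by auto

lemma superlevel_0: "superlevel G 0 = verts G"
  using height_nonneg by (auto simp: superlevel_def)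

lemma level_component_0:
  assumes v: "v \<in> verts G"
  shows "level_component 0 v = verts G"
proof
  show "level_component 0 v \<subseteq> verts G"
    using level_component_subset superlevel_subset by blast
  show "verts G \<subseteq> level_component 0 v"
  proof
    fix w assume "w \<in> verts G"
    show "w \<in> level_component 0 v"
    proof (rule connected_closed_set[OF tree_connected _ v _ \<open>w \<in> verts G\<close>])
      show "v \<in> level_component 0 v"
        using v superlevel_0 level_component_self by simp
    qed (use level_component_arc_iff height_nonneg in simp)
  qed
qed

lemma level_component_mono:
  assumes "a \<le> b" "v \<in> superlevel G b"
  shows "level_component b v \<subseteq> level_component a v"
proof
  fix w assume w: "w \<in> level_component b v"
  show "w \<in> level_component a v"
    by (rule level_component_least[OF w level_component_self])
      (use assms level_component_arc_iff in \<open>auto simp: superlevel_def\<close>)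
qed

section \<open>Superlevel components belong to the family\<close>

lemma receiver_region_arc:
  assumes "e \<in> arcs G" "head G e \<noteq> v"
  shows "tail G e \<in> receiver_region G v \<longleftrightarrow> head G e \<in> receiver_region G v"
proof -
  interpret K: wf_digraph "G\<lparr>arcs := arcs G - in_arcs G v\<rparr>" by unfold_locales auto
  show ?thesis
    unfolding receiver_region_def using K.undirected_component_arc[of e] assms by simp
qed

lemma receiver_region_self: "v \<in> verts G \<Longrightarrow> v \<in> receiver_region G v"
proof -
  interpret K: wf_digraph "G\<lparr>arcs := arcs G - in_arcs G v\<rparr>" by unfold_locales auto
  show "v \<in> verts G \<Longrightarrow> v \<in> receiver_region G v"
    unfolding receiver_region_def by (rule K.undirected_component_self) simp
qed

lemma receiver_region_subset_head_side:
  assumes e: "e \<in> arcs G"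
  shows "receiver_region G (head G e) \<subseteq> head_side e"
proof
  interpret K: wf_digraph "G\<lparr>arcs := arcs G - in_arcs G (head G e)\<rparr>" by unfold_locales auto
  fix w assume "w \<in> receiver_region G (head G e)"
  then show "w \<in> head_side e"
    unfolding receiver_region_def
  proof (rule K.undirected_component_least)
    show "head G e \<in> head_side e" by (rule head_in_head_side[OF e])
  next
    fix f assume "f \<in> arcs (G\<lparr>arcs := arcs G - in_arcs G (head G e)\<rparr>)"
    then have "f \<in> arcs G" "f \<noteq> e" using e by auto
    then show "tail (G\<lparr>arcs := arcs G - in_arcs G (head G e)\<rparr>) f \<in> head_side e
        \<longleftrightarrow> head (G\<lparr>arcs := arcs G - in_arcs G (head G e)\<rparr>) f \<in> head_side e"
      using head_side_arc by simp
  qed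
qed

text \<open>
  A superlevel component \<open>\<Omega>\<close> at a positive level is entered by edges from the level below and left
  by none.  The vertices where it is entered serve as the set \<open>J\<close>: their regions contain \<open>\<Omega>\<close>,
  and a vertex outside \<open>\<Omega>\<close> is separated from it by one of the entering bridges.
\<close>

lemma level_component_in_family_L:
  assumes a: "1 \<le> a" and r: "r \<in> superlevel G a"
  shows "level_component a r \<in> family_L G"
proof -
  let ?W = "level_component a r"
  define B where "B = {e \<in> arcs G. head G e \<in> ?W \<and> tail G e \<notin> ?W}"
  define J where "J = head G ` B"
  have rW: "r \<in> ?W" by (rule level_component_self[OF r])
  have W_height: "a \<le> height G v" "v \<in> verts G" if "v \<in> ?W" for v
    using that level_component_subset[of a r] by (auto simp: superlevel_def)
  have B_height: "height G (head G e) = a" if "e \<in> B" for e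
  proof -
    have "\<not> a \<le> height G (tail G e)"
      using that level_component_arc_iff[of e a r] by (auto simp: B_def)
    moreover have "a \<le> height G (head G e)"
      using that W_height by (auto simp: B_def)
    ultimately show ?thesis
      using that height_head[of e] by (auto simp: B_def)
  qed
  have not_leaving: "head G e \<in> ?W" if "e \<in> arcs G" "tail G e \<in> ?W" for e
    using that level_component_arc_iff[of e a r] W_height by auto
  have "B \<noteq> {}"
  proof
    assume "B = {}"
    then have closed: "tail G e \<in> ?W \<longleftrightarrow> head G e \<in> ?W" if "e \<in> arcs G" for e
      using not_leaving that by (auto simp: B_def)
    obtain z where z: "z \<in> verts G" "height G z = 0" using height_zero_exists by auto
    have "z \<in> ?W"
      using connected_closed_set[OF tree_connected closed _ rW z(1)] W_height[OF rW] by simp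
    with z a W_height show False by force
  qed
  then have J: "J \<noteq> {}" by (simp add: J_def)
  have J_receivers: "J \<subseteq> receivers G" by (auto simp: J_def B_def receivers_def)
  have le: "?W \<subseteq> receiver_region G v" if v: "v \<in> J" for v
  proof
    have vW: "v \<in> ?W" and hv: "height G v = a"
      using v B_height by (auto simp: J_def B_def)
    fix w assume "w \<in> ?W"
    then have "w \<in> level_component a v"
      using level_component_eq[OF vW] by simp
    then show "w \<in> receiver_region G v"
    proof (rule level_component_least)
      show "v \<in> receiver_region G v" by (rule receiver_region_self) (rule W_height(2)[OF vW])
    next
      fix e assume e: "e \<in> arcs G" "a \<le> height G (tail G e)"
      with height_head[OF e(1)] hv have "head G e \<noteq> v" by auto
      with e show "tail G e \<in> receiver_region G v \<longleftrightarrow> head G e \<in> receiver_region G v"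
        by (intro receiver_region_arc)
    qed
  qed
  have ge: "(\<Inter>v\<in>J. receiver_region G v) \<subseteq> ?W"
  proof
    fix w assume w: "w \<in> (\<Inter>v\<in>J. receiver_region G v)"
    \<comment> \<open>No edge leaves \<open>X\<close>: an entering edge of \<open>\<Omega>\<close> has no end in \<open>X\<close>, and any other edge stays on one
      side of every entering bridge and on one side of \<open>\<Omega>\<close>.\<close>
    define X where "X = {x. x \<notin> ?W \<and> (\<forall>e\<in>B. x \<in> head_side e)}"
    have w_sides: "\<forall>e\<in>B. w \<in> head_side e"
      using w receiver_region_subset_head_side by (fastforce simp: J_def B_def)
    have wG: "w \<in> verts G"
      using w_sides \<open>B \<noteq> {}\<close> head_side_subset by blast
    show "w \<in> ?W"
    proof (rule ccontr)
      assume "w \<notin> ?W"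
      with w_sides have wX: "w \<in> X" by (simp add: X_def)
      have closed: "tail G f \<in> X \<longleftrightarrow> head G f \<in> X" if f: "f \<in> arcs G" for f
      proof (cases "f \<in> B")
        case True
        then show ?thesis
          using tail_notin_head_side[OF f] by (auto simp: X_def B_def)
      next
        case False
        then have "tail G f \<in> head_side e \<longleftrightarrow> head G f \<in> head_side e" if "e \<in> B" for e
          using that head_side_arc[OF f, of e] by auto
        moreover have "tail G f \<in> ?W \<longleftrightarrow> head G f \<in> ?W"
          using False not_leaving f by (auto simp: B_def)
        ultimately show ?thesis by (auto simp: X_def)
      qed
      have "r \<in> X"
        using connected_closed_set[OF tree_connected closed wG wX] W_height(2)[OF rW] by simp
      with rW show False by (simp add: X_def)
    qed
  qed
  have "?W = (\<Inter>v\<in>J. receiver_region G v)"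
    using le ge by blast
  with J J_receivers rW show ?thesis
    unfolding family_L_def by blast
qed

end

section \<open>Flows along the edges\<close>

context oriented_tree
begin

definition outflow :: "('b \<Rightarrow> 'k::ab_group_add) \<Rightarrow> 'a \<Rightarrow> 'k" where
  "outflow u v = (\<Sum>e\<in>out_arcs G v. u e)"

definition inflow :: "('b \<Rightarrow> 'k::ab_group_add) \<Rightarrow> 'a \<Rightarrow> 'k" where
  "inflow u v = (\<Sum>e\<in>in_arcs G v. u e)"

lemma sum_outflow: "finite W \<Longrightarrow> (\<Sum>v\<in>W. outflow u v) = (\<Sum>e\<in>{e \<in> arcs G. tail G e \<in> W}. u e)"
  and sum_inflow: "finite W \<Longrightarrow> (\<Sum>v\<in>W. inflow u v) = (\<Sum>e\<in>{e \<in> arcs G. head G e \<in> W}. u e)"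
proof -
  assume W: "finite W"
  have "(\<Sum>v\<in>W. outflow u v) = (\<Sum>v\<in>W. sum u {e \<in> {e \<in> arcs G. tail G e \<in> W}. tail G e = v})"
    unfolding outflow_def by (intro sum.cong refl arg_cong[of _ _ "sum u"]) auto
  also have "\<dots> = (\<Sum>e\<in>{e \<in> arcs G. tail G e \<in> W}. u e)"
    by (rule sum.group) (use W in auto)
  finally show "(\<Sum>v\<in>W. outflow u v) = (\<Sum>e\<in>{e \<in> arcs G. tail G e \<in> W}. u e)" .
  have "(\<Sum>v\<in>W. inflow u v) = (\<Sum>v\<in>W. sum u {e \<in> {e \<in> arcs G. head G e \<in> W}. head G e = v})"
    unfolding inflow_def by (intro sum.cong refl arg_cong[of _ _ "sum u"]) auto
  also have "\<dots> = (\<Sum>e\<in>{e \<in> arcs G. head G e \<in> W}. u e)"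
    by (rule sum.group) (use W in auto)
  finally show "(\<Sum>v\<in>W. inflow u v) = (\<Sum>e\<in>{e \<in> arcs G. head G e \<in> W}. u e)" .
qed

lemma sum_over_components:
  assumes U: "U \<subseteq> superlevel G b" and closed: "\<And>w. w \<in> U \<Longrightarrow> level_component b w \<subseteq> U"
  shows "sum g U = (\<Sum>\<Omega>\<in>level_component b ` U. sum g \<Omega>)"
proof -
  have fin: "finite U"
    using U superlevel_subset finite_verts finite_subset by metis
  have "(\<Sum>\<Omega>\<in>level_component b ` U. sum g \<Omega>)
      = (\<Sum>\<Omega>\<in>level_component b ` U. sum g {w \<in> U. level_component b w = \<Omega>})"
  proof (intro sum.cong refl arg_cong[of _ _ "sum g"])
    fix \<Omega> assume "\<Omega> \<in> level_component b ` U"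
    then obtain r where r: "r \<in> U" "\<Omega> = level_component b r" by auto
    show "\<Omega> = {w \<in> U. level_component b w = \<Omega>}"
      using closed[OF r(1)] r(2) level_component_eq[of _ b r] level_component_self[of _ b] U
      by blast
  qed
  also have "\<dots> = sum g U"
    by (rule sum.group) (use fin in auto)
  finally show ?thesis by simp
qed

text \<open>
  A flow on a forest is determined by its node balances: the flow through a bridge is the sum of
  the balances on its head side.  Here the nodes are the vertices of height \<open>a\<close> and the components
  one level up.
\<close>

lemma flow_zero_of_balances_zero:
  fixes u :: "'b \<Rightarrow> 'k::ab_group_add"
  assumes out: "\<And>v. v \<in> verts G \<Longrightarrow> height G v = a \<Longrightarrow> outflow u v = 0"
    and net: "\<And>w. w \<in> superlevel G (a + 1)
      \<Longrightarrow> (\<Sum>v\<in>level_component (a + 1) w. inflow u v - outflow u v) = 0"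
    and e: "e \<in> arcs G" "height G (tail G e) = a"
  shows "u e = 0"
proof -
  let ?T = "head_side e"
  define U where "U = {v \<in> ?T. a + 1 \<le> height G v}"
  define B where "B = {v \<in> ?T. height G v = a}"
  have fin: "finite ?T"
    using head_side_subset finite_verts finite_subset by metis
  then have fin_U: "finite U" and fin_B: "finite B"
    by (auto simp: U_def B_def)
  have U: "U \<subseteq> superlevel G (a + 1)"
    using head_side_subset by (auto simp: U_def superlevel_def)
  have closed: "level_component (a + 1) w \<subseteq> U" if w: "w \<in> U" for w
  proof
    fix x assume x: "x \<in> level_component (a + 1) w"
    have "x \<in> ?T"
    proof (rule level_component_least[OF x])
      show "w \<in> ?T" using w by (simp add: U_def)
    next
      fix f assume "f \<in> arcs G" "a + 1 \<le> height G (tail G f)"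
      with e(2) show "tail G f \<in> ?T \<longleftrightarrow> head G f \<in> ?T"
        by (intro head_side_arc) auto
    qed
    with x show "x \<in> U"
      using level_component_subset[of "a + 1" w] by (auto simp: U_def superlevel_def)
  qed
  have "(\<Sum>v\<in>U. inflow u v - outflow u v)
      = (\<Sum>\<Omega>\<in>level_component (a + 1) ` U. \<Sum>v\<in>\<Omega>. inflow u v - outflow u v)"
    by (rule sum_over_components[OF U]) (rule closed)
  also have "\<dots> = 0"
    by (rule sum.neutral) (use net U in blast)
  finally have "(\<Sum>v\<in>U. inflow u v - outflow u v) = 0" .
  then have "sum u {f \<in> arcs G. head G f \<in> U} = sum u {f \<in> arcs G. tail G f \<in> U}"
    using fin_U by (simp add: sum_subtractf sum_inflow sum_outflow)
  moreover have "sum u {f \<in> arcs G. tail G f \<in> B} = 0"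
    unfolding sum_outflow[OF fin_B, symmetric] using out head_side_subset
    by (intro sum.neutral) (auto simp: B_def)
  moreover have "{f \<in> arcs G. head G f \<in> U}
      = insert e ({f \<in> arcs G. tail G f \<in> U} \<union> {f \<in> arcs G. tail G f \<in> B})"
  proof (rule Set.set_eqI)
    fix f
    show "f \<in> {f \<in> arcs G. head G f \<in> U}
        \<longleftrightarrow> f \<in> insert e ({f \<in> arcs G. tail G f \<in> U} \<union> {f \<in> arcs G. tail G f \<in> B})"
    proof (cases "f = e")
      case True
      then show ?thesis
        using e height_head[OF e(1)] head_in_head_side by (simp add: U_def)
    next
      case False
      then show ?thesis
        using head_side_arc[of f e] height_head[of f] by (auto simp: U_def B_def)
    qed
  qed
  then have "sum u {f \<in> arcs G. head G f \<in> U}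
      = u e + (sum u {f \<in> arcs G. tail G f \<in> U} + sum u {f \<in> arcs G. tail G f \<in> B})"
    using tail_notin_head_side[OF e(1)]
    by (simp, subst sum.insert) (auto simp: U_def B_def intro!: sum.union_disjoint)
  ultimately show ?thesis by simp
qed

section \<open>The weights of the components\<close>

context
  fixes \<beta> :: real
  assumes \<beta>_pos: "0 < \<beta>"
begin

lemma kappa_pos:
  assumes "v \<in> superlevel G a"
  shows "0 < kappa G \<beta> a (level_component a v)"
proof -
  have "0 < (\<Sum>w\<in>level_component a v. \<beta> powi (a - height G w))"
    using \<beta>_pos level_component_self[OF assms] finite_level_component
    by (intro sum_pos) auto
  then show ?thesis by (simp add: kappa_def)
qed

lemma kappa_weights_sum:
  assumes "v \<in> superlevel G a"
  shows "(\<Sum>w\<in>level_component a v. \<beta> powi (a - height G w)) * kappa G \<beta> a (level_component a v) = 1"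
  using kappa_pos[OF assms] by (simp add: kappa_def)

text \<open>
  On each component the factors \<open>\<beta>\<^bsup>b - h\<^esup> \<kappa>\<close> are weights of total one, so redistributing the mass of
  every component according to them preserves the total.
\<close>

lemma kappa_average:
  fixes y :: "'a \<Rightarrow> 'k::real_vector"
  assumes U: "U \<subseteq> superlevel G b" and closed: "\<And>w. w \<in> U \<Longrightarrow> level_component b w \<subseteq> U"
  shows "(\<Sum>w\<in>U. (\<beta> powi (b - height G w) * kappa G \<beta> b (level_component b w))
      *\<^sub>R sum y (level_component b w)) = sum y U"
proof -
  let ?f = "\<lambda>w. (\<beta> powi (b - height G w) * kappa G \<beta> b (level_component b w))
      *\<^sub>R sum y (level_component b w)"
  have "sum ?f U = (\<Sum>\<Omega>\<in>level_component b ` U. sum ?f \<Omega>)"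
    by (rule sum_over_components[OF U]) (rule closed)
  also have "\<dots> = (\<Sum>\<Omega>\<in>level_component b ` U. sum y \<Omega>)"
  proof (rule sum.cong[OF refl])
    fix \<Omega> assume "\<Omega> \<in> level_component b ` U"
    then obtain r where r: "r \<in> superlevel G b" "\<Omega> = level_component b r"
      using U by auto
    have "(\<Sum>w\<in>\<Omega>. (\<beta> powi (b - height G w) * kappa G \<beta> b (level_component b w))
        *\<^sub>R sum y (level_component b w))
        = (\<Sum>w\<in>\<Omega>. (\<beta> powi (b - height G w) * kappa G \<beta> b \<Omega>) *\<^sub>R sum y \<Omega>)"
      using r(2) level_component_eq[of _ b r] by (intro sum.cong refl) simp
    also have "\<dots> = ((\<Sum>w\<in>\<Omega>. \<beta> powi (b - height G w)) * kappa G \<beta> b \<Omega>) *\<^sub>R sum y \<Omega>"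
      by (simp add: sum_distrib_right scaleR_sum_left)
    also have "\<dots> = sum y \<Omega>"
      using kappa_weights_sum[OF r(1)] r(2) by simp
    finally show "(\<Sum>w\<in>\<Omega>. (\<beta> powi (b - height G w) * kappa G \<beta> b (level_component b w))
        *\<^sub>R sum y (level_component b w)) = sum y \<Omega>" .
  qed
  also have "\<dots> = sum y U"
    by (rule sum_over_components[OF U, symmetric]) (rule closed)
  finally show ?thesis .
qed

end

end

section \<open>The value function\<close>

context oriented_tree
begin

definition cost_to_go :: "real \<Rightarrow> ('a \<Rightarrow> 'k::real_vector) \<Rightarrow> 'a \<Rightarrow> 'k" where
  "cost_to_go \<beta> x v = q0 G \<beta> *\<^sub>R sum x (verts G)
     + (\<Sum>a\<in>{1..height G v}. kappa G \<beta> a (level_component a v) *\<^sub>R sum x (level_component a v))"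

lemma cost_to_go_add: "cost_to_go \<beta> (\<lambda>v. x v + y v) v = cost_to_go \<beta> x v + cost_to_go \<beta> y v"
  by (simp add: cost_to_go_def sum.distrib scaleR_right_distrib)

lemma cost_to_go_arc:
  assumes e: "e \<in> arcs G"
  defines "b \<equiv> height G (head G e)"
  shows "cost_to_go \<beta> x (head G e) - cost_to_go \<beta> x (tail G e)
    = kappa G \<beta> b (level_component b (head G e)) *\<^sub>R sum x (level_component b (head G e))"
proof -
  let ?t = "\<lambda>v a. kappa G \<beta> a (level_component a v) *\<^sub>R sum x (level_component a v)"
  have b: "b = height G (tail G e) + 1" "1 \<le> b"
    using height_head[OF e] height_nonneg[of "tail G e"] e by (auto simp: b_def)
  have "{1..b} = insert b {1..height G (tail G e)}"
    using b by auto
  then have "sum (?t (head G e)) {1..b}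
      = ?t (head G e) b + sum (?t (head G e)) {1..height G (tail G e)}"
    using b by simp
  also have "sum (?t (head G e)) {1..height G (tail G e)} = sum (?t (tail G e)) {1..height G (tail G e)}"
    by (intro sum.cong refl) (simp add: level_component_arc[OF e])
  finally show ?thesis
    by (simp add: cost_to_go_def b_def)
qed

text \<open>
  The coefficient \<open>q\<^sub>0\<close> is the fixed point of \<open>q = \<beta> q + \<kappa>\<^bsub>0,V\<^esub>\<close>: the total mass never changes, so its
  bottom-level cost is paid again in every period.
\<close>

lemma q0_fixed_point:
  assumes "0 < \<beta>" "\<beta> < 1" "v \<in> verts G"
  shows "q0 G \<beta> = \<beta> * q0 G \<beta> + kappa G \<beta> 0 (level_component 0 v)" and "0 < q0 G \<beta>"
proof -
  define s where "s = (\<Sum>v\<in>verts G. \<beta> powi (- height G v))"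
  have s: "0 < s"
    unfolding s_def using assms(1) verts_nonempty by (intro sum_pos) auto
  have k: "kappa G \<beta> 0 (level_component 0 v) = 1 / s"
    using level_component_0[OF assms(3)] by (simp add: kappa_def s_def divide_inverse)
  have q: "q0 G \<beta> = 1 / ((1 - \<beta>) * s)"
    by (simp add: q0_def s_def)
  show "0 < q0 G \<beta>"
    unfolding q using s assms(2) by simp
  show "q0 G \<beta> = \<beta> * q0 G \<beta> + kappa G \<beta> 0 (level_component 0 v)"
    unfolding q k using s assms(2) by (simp add: field_simps)
qed

end

section \<open>Stationary flows and the Bellman equation\<close>

text \<open>
  One step of the shipping problem from state \<open>x\<close> to state \<open>z\<close>.  The last assumption says that the
  derivative of \<open>\<parallel>y\<parallel>\<^sup>2\<close> plus the discounted cost of \<open>z\<close> vanishes in the flow along each edge, since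
  \<open>cost_to_go\<close> is half the gradient of that cost.  Values lie in any real vector space, because the
  same facts are applied to the complex eigenvectors of the closed loop.
\<close>

locale stationary_flow = oriented_tree G for G :: "('a, 'b) pre_digraph" +
  fixes \<beta> :: real and x y z :: "'a \<Rightarrow> 'k::real_vector" and u :: "'b \<Rightarrow> 'k"
  assumes \<beta>_pos: "0 < \<beta>"
    and residual: "\<And>v. y v = x v - outflow u v"
    and successor: "\<And>v. z v = y v + inflow u v"
    and stationary: "\<And>e. e \<in> arcs G
      \<Longrightarrow> y (tail G e) = \<beta> *\<^sub>R (cost_to_go \<beta> z (head G e) - cost_to_go \<beta> z (tail G e))"
begin

lemma total_mass_conserved: "sum z (verts G) = sum x (verts G)"
proof -
  have "{e \<in> arcs G. head G e \<in> verts G} = {e \<in> arcs G. tail G e \<in> verts G}" by auto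
  then show ?thesis
    by (simp add: residual successor sum.distrib sum_subtractf sum_inflow sum_outflow)
qed

text \<open>
  No edge leaves a superlevel component, and every edge entering one of its higher vertices starts
  inside it.  Hence the mass of the component is what remains at its bottom vertices after
  shipping plus what its higher vertices hold afterwards.
\<close>

lemma component_mass_balance:
  "sum y {v \<in> level_component a r. height G v = a}
      + sum z {v \<in> level_component a r. a + 1 \<le> height G v} = sum x (level_component a r)"
proof -
  let ?W = "level_component a r"
  let ?B = "{v \<in> ?W. height G v = a}" and ?T = "{v \<in> ?W. a + 1 \<le> height G v}"
  have fin: "finite ?W" by (rule finite_level_component)
  have W_height: "a \<le> height G v" if "v \<in> ?W" for v
    using that level_component_subset[of a r] by (auto simp: superlevel_def)
  have split: "?W = ?B \<union> ?T"
    using W_height by fastforce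
  have "{e \<in> arcs G. head G e \<in> ?T} = {e \<in> arcs G. tail G e \<in> ?W}"
    using level_component_arc_iff[of _ a r] W_height height_head by fastforce
  then have io: "sum (inflow u) ?T = sum (outflow u) ?W"
    using sum_inflow[of ?T u] sum_outflow[OF fin, of u] fin by simp
  have "sum y ?B + sum z ?T = (sum y ?B + sum y ?T) + sum (inflow u) ?T"
    by (simp add: successor sum.distrib)
  also have "sum y ?B + sum y ?T = sum y ?W"
    by (subst (3) split, rule sum.union_disjoint[symmetric]) (use fin in auto)
  also have "sum y ?W + sum (inflow u) ?T = sum x ?W"
    unfolding io by (simp add: residual sum_subtractf)
  finally show ?thesis .
qed

text \<open>
  Stationarity along an edge equates the residual at the sender with the discounted price of the
  component that the edge enters.  Inside a component of level \<open>a\<close> all these prices therefore agree,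
  and mass balance identifies the common price as \<open>\<kappa>\<close> times the mass of the component.
\<close>

lemma component_price:
  assumes v: "v \<in> superlevel G a"
  shows "(if height G v = a then y v
      else (\<beta> * kappa G \<beta> (a + 1) (level_component (a + 1) v)) *\<^sub>R sum z (level_component (a + 1) v))
    = kappa G \<beta> a (level_component a v) *\<^sub>R sum x (level_component a v)"
proof -
  define p where "p w = (if height G w = a then y w
      else (\<beta> * kappa G \<beta> (a + 1) (level_component (a + 1) w)) *\<^sub>R sum z (level_component (a + 1) w))"
    for w
  let ?W = "level_component a v"
  let ?B = "{w \<in> ?W. height G w = a}" and ?T = "{w \<in> ?W. a + 1 \<le> height G w}"
  have p_const: "p w = p v" if "w \<in> ?W" for w
    using that
  proof (rule constant_on_level_component)
    fix e assume e: "e \<in> arcs G" "a \<le> height G (tail G e)"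
    note [simp] = height_head[OF e(1)]
    show "p (tail G e) = p (head G e)"
    proof (cases "height G (tail G e) = a")
      case True
      then show ?thesis
        using stationary[OF e(1)] cost_to_go_arc[OF e(1), of \<beta> z] by (simp add: p_def)
    next
      case False
      then show ?thesis
        using e level_component_arc[OF e(1), of "a + 1"] by (simp add: p_def)
    qed
  qed
  have fin: "finite ?W" by (rule finite_level_component)
  have W_height: "a \<le> height G w" if "w \<in> ?W" for w
    using that level_component_subset[of a v] by (auto simp: superlevel_def)
  have split: "?W = ?B \<union> ?T"
    using W_height by fastforce
  have T: "?T \<subseteq> superlevel G (a + 1)"
    using level_component_subset[of a v] by (auto simp: superlevel_def)
  have T_closed: "level_component (a + 1) w \<subseteq> ?T" if "w \<in> ?T" for w
    using that T level_component_mono[of a "a + 1" w] level_component_eq[of w a v]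
      level_component_subset[of "a + 1" w] by (auto simp: superlevel_def)
  have "(\<Sum>w\<in>?W. \<beta> powi (a - height G w)) *\<^sub>R p v = (\<Sum>w\<in>?W. \<beta> powi (a - height G w) *\<^sub>R p w)"
    unfolding scaleR_sum_left using p_const by (intro sum.cong) auto
  also have "\<dots> = (\<Sum>w\<in>?B. \<beta> powi (a - height G w) *\<^sub>R p w)
      + (\<Sum>w\<in>?T. \<beta> powi (a - height G w) *\<^sub>R p w)"
    by (subst split, rule sum.union_disjoint) (use fin in auto)
  also have "(\<Sum>w\<in>?B. \<beta> powi (a - height G w) *\<^sub>R p w) = sum y ?B"
    by (intro sum.cong) (auto simp: p_def)
  also have "(\<Sum>w\<in>?T. \<beta> powi (a - height G w) *\<^sub>R p w)
      = (\<Sum>w\<in>?T. (\<beta> powi (a + 1 - height G w) * kappa G \<beta> (a + 1) (level_component (a + 1) w))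
        *\<^sub>R sum z (level_component (a + 1) w))"
  proof (intro sum.cong refl)
    fix w assume w: "w \<in> ?T"
    have "\<beta> powi (a + 1 - height G w) = \<beta> powi (a - height G w) * \<beta>"
      using \<beta>_pos power_int_add_1[of \<beta> "a - height G w"] by (simp add: algebra_simps)
    with w show "\<beta> powi (a - height G w) *\<^sub>R p w
        = (\<beta> powi (a + 1 - height G w) * kappa G \<beta> (a + 1) (level_component (a + 1) w))
          *\<^sub>R sum z (level_component (a + 1) w)"
      by (simp add: p_def mult.assoc)
  qed
  also have "\<dots> = sum z ?T"
    by (rule kappa_average[OF \<beta>_pos T T_closed])
  also have "sum y ?B + sum z ?T = sum x ?W"
    by (rule component_mass_balance)
  finally have total: "(\<Sum>w\<in>?W. \<beta> powi (a - height G w)) *\<^sub>R p v = sum x ?W" .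
  have "p v = kappa G \<beta> a ?W *\<^sub>R ((\<Sum>w\<in>?W. \<beta> powi (a - height G w)) *\<^sub>R p v)"
    using kappa_weights_sum[OF \<beta>_pos v] by (simp add: mult.commute)
  then show ?thesis
    unfolding total by (simp add: p_def)
qed

text \<open>
  Along the chain of components containing \<open>v\<close>, the discounted price of a component after the step
  is the price of the next larger one before the step; the residual at \<open>v\<close> is the price of the
  smallest one, and the sum telescopes.
\<close>

lemma bellman_equation:
  assumes \<beta>: "\<beta> < 1" and v: "v \<in> verts G"
  shows "cost_to_go \<beta> x v = y v + \<beta> *\<^sub>R cost_to_go \<beta> z v"
proof -
  define t where "t a = kappa G \<beta> a (level_component a v) *\<^sub>R sum x (level_component a v)" for a
  define t' where "t' a = kappa G \<beta> a (level_component a v) *\<^sub>R sum z (level_component a v)" for a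
  define h where "h = height G v"
  have h: "0 \<le> h" using height_nonneg[OF v] by (simp add: h_def)
  have bottom: "y v = t h"
    using component_price[of v h] v by (simp add: superlevel_def h_def t_def)
  have step: "\<beta> *\<^sub>R t' (a + 1) = t a" if "0 \<le> a" "a < h" for a
    using component_price[of v a] v that by (simp add: superlevel_def h_def t_def t'_def)
  have "(\<Sum>a\<in>{1..h}. \<beta> *\<^sub>R t' a) = sum t {0..h - 1}"
    by (rule sum.reindex_bij_witness[of _ "\<lambda>a. a + 1" "\<lambda>a. a - 1"])
      (use step[of "_ - 1"] in auto)
  then have "y v + (\<Sum>a\<in>{1..h}. \<beta> *\<^sub>R t' a) = sum t (insert h {0..h - 1})"
    by (simp add: bottom)
  also have "insert h {0..h - 1} = insert 0 {1..h}"
    using h by auto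
  also have "sum t (insert 0 {1..h}) = t 0 + sum t {1..h}"
    by simp
  finally have telescope: "y v + (\<Sum>a\<in>{1..h}. \<beta> *\<^sub>R t' a) = t 0 + sum t {1..h}" .
  have t0: "t 0 = kappa G \<beta> 0 (level_component 0 v) *\<^sub>R sum x (verts G)"
    by (simp add: t_def level_component_0[OF v])
  have q0: "q0 G \<beta> *\<^sub>R sum x (verts G) = (\<beta> * q0 G \<beta>) *\<^sub>R sum x (verts G) + t 0"
    using q0_fixed_point(1)[OF \<beta>_pos \<beta> v] t0 by (metis scaleR_left_distrib)
  have "y v + \<beta> *\<^sub>R cost_to_go \<beta> z v
      = (\<beta> * q0 G \<beta>) *\<^sub>R sum x (verts G) + (y v + (\<Sum>a\<in>{1..h}. \<beta> *\<^sub>R t' a))"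
    by (simp add: cost_to_go_def t'_def h_def total_mass_conserved scaleR_right_distrib
        scaleR_sum_right)
  also have "\<dots> = cost_to_go \<beta> x v"
    unfolding telescope by (simp add: cost_to_go_def q0 t_def h_def)
  finally show ?thesis by simp
qed

lemma massless_component:
  assumes v: "v \<in> superlevel G a" and zero: "sum x (level_component a v) = 0"
  shows "height G v = a \<Longrightarrow> y v = 0"
    and "a + 1 \<le> height G v \<Longrightarrow> sum z (level_component (a + 1) v) = 0"
proof -
  show "height G v = a \<Longrightarrow> y v = 0"
    using component_price[OF v] zero by simp
  assume h: "a + 1 \<le> height G v"
  then have "0 < kappa G \<beta> (a + 1) (level_component (a + 1) v)"
    using v by (intro kappa_pos[OF \<beta>_pos]) (simp add: superlevel_def)
  then show "sum z (level_component (a + 1) v) = 0"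
    using component_price[OF v] zero h \<beta>_pos by simp
qed

text \<open>
  A zero state leaves no residual and no mass in any higher component after the step, so all node
  balances of the flow vanish.
\<close>

lemma flow_zero_of_state_zero:
  assumes x: "\<And>v. v \<in> verts G \<Longrightarrow> x v = 0" and e: "e \<in> arcs G"
  shows "u e = 0"
proof -
  have zero: "sum x (level_component a v) = 0" for a v
    by (rule sum.neutral) (use x level_component_subset superlevel_subset in blast)
  show ?thesis
  proof (rule flow_zero_of_balances_zero[OF _ _ e refl])
    fix v assume v: "v \<in> verts G" "height G v = height G (tail G e)"
    then show "outflow u v = 0"
      using massless_component(1)[OF _ zero, of v "height G v"] x residual[of v]
      by (simp add: superlevel_def)
  next
    let ?b = "height G (tail G e) + 1"
    fix w assume "w \<in> superlevel G ?b"
    then have "sum z (level_component ?b w) = 0"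
      using massless_component(2)[OF _ zero, of w "height G (tail G e)"]
      by (simp add: superlevel_def)
    moreover have "sum z (level_component ?b w)
        = (\<Sum>v\<in>level_component ?b w. inflow u v - outflow u v)"
      by (rule sum.cong[OF refl])
        (use x level_component_subset superlevel_subset in \<open>force simp: residual successor\<close>)
    ultimately show "(\<Sum>v\<in>level_component ?b w. inflow u v - outflow u v) = 0"
      by simp
  qed
qed

end

text \<open>
  The step from \<open>x\<close> to \<open>z\<close> is triangular along the levels: total mass is conserved, and the mass
  of a component after the step is a multiple of the mass of the component one level below that
  contains it, before the step.  For an eigenvalue other than \<open>0\<close> and \<open>1\<close> all masses vanish, then from the bottom up all flows and all
  entries of the eigenvector.
\<close>

locale stationary_eigenflow = stationary_flow G \<beta> x y z u
  for G :: "('a, 'b) pre_digraph" and \<beta> and x y z :: "'a \<Rightarrow> 'k::real_normed_field" and u +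
  fixes \<mu> :: 'k
  assumes eigen: "\<And>v. v \<in> verts G \<Longrightarrow> z v = \<mu> * x v"
    and \<mu>: "\<mu> \<noteq> 0" "\<mu> \<noteq> 1"
begin

lemma masses_zero:
  assumes "0 \<le> a" "v \<in> superlevel G a"
  shows "sum x (level_component a v) = 0"
proof -
  have sum_z: "sum z (level_component a w) = \<mu> * sum x (level_component a w)" for a w
    unfolding sum_distrib_left
    by (intro sum.cong refl eigen) (use level_component_subset superlevel_subset in blast)
  have "sum x (level_component (int n) w) = 0" if "w \<in> superlevel G (int n)" for n w
    using that
  proof (induction n)
    case 0
    then have w: "w \<in> verts G" by (simp add: superlevel_def)
    have "sum x (verts G) = \<mu> * sum x (verts G)"
      using total_mass_conserved eigen by (simp add: sum_distrib_left)
    then show ?case using \<mu> level_component_0[OF w] by simp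
  next
    case (Suc n)
    then have w: "w \<in> superlevel G (int n)" "int n + 1 \<le> height G w"
      by (auto simp: superlevel_def)
    have "sum z (level_component (int n + 1) w) = 0"
      by (rule massless_component(2)[OF w(1) Suc.IH[OF w(1)] w(2)])
    then show ?case using sum_z \<mu> by (simp add: add.commute)
  qed
  from this[of v "nat a"] assms show ?thesis by simp
qed

lemma outflow_eq: "v \<in> verts G \<Longrightarrow> outflow u v = x v"
  using massless_component(1)[OF _ masses_zero, of v "height G v"] height_nonneg[of v] residual[of v]
  by (simp add: superlevel_def)

lemma inflow_eq: "v \<in> verts G \<Longrightarrow> inflow u v = \<mu> * x v"
  using eigen outflow_eq successor residual by simp

lemma flow_zero_of_level_zero:
  assumes x: "\<And>v. v \<in> verts G \<Longrightarrow> height G v = a \<Longrightarrow> x v = 0"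
    and e: "e \<in> arcs G" "height G (tail G e) = a"
  shows "u e = 0"
proof (rule flow_zero_of_balances_zero[OF _ _ e])
  show "\<And>v. v \<in> verts G \<Longrightarrow> height G v = a \<Longrightarrow> outflow u v = 0"
    using x outflow_eq by simp
next
  fix w assume w: "w \<in> superlevel G (a + 1)"
  have "(\<Sum>v\<in>level_component (a + 1) w. inflow u v - outflow u v)
      = (\<Sum>v\<in>level_component (a + 1) w. (\<mu> - 1) * x v)"
  proof (rule sum.cong[OF refl])
    fix v assume "v \<in> level_component (a + 1) w"
    then have "v \<in> verts G" using level_component_subset superlevel_subset by blast
    then show "inflow u v - outflow u v = (\<mu> - 1) * x v"
      by (simp add: inflow_eq outflow_eq algebra_simps)
  qed
  also have "\<dots> = 0"
    using masses_zero[OF _ w] height_nonneg[of "tail G e"] e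
    by (simp add: sum_distrib_left[symmetric])
  finally show "(\<Sum>v\<in>level_component (a + 1) w. inflow u v - outflow u v) = 0" .
qed

lemma state_zero:
  assumes "v \<in> verts G"
  shows "x v = 0"
proof -
  have "\<forall>w\<in>verts G. height G w = int n \<longrightarrow> x w = 0" for n
  proof (induction n rule: less_induct)
    case (less n)
    have "x w = 0" if w: "w \<in> verts G" "height G w = int n" for w
    proof -
      have "u e = 0" if e: "e \<in> in_arcs G w" for e
      proof (rule flow_zero_of_level_zero)
        show "e \<in> arcs G" using e by simp
        fix v assume v: "v \<in> verts G" "height G v = height G (tail G e)"
        then have "height G v = int n - 1"
          using height_head[of e] e w by simp
        with v show "x v = 0"
          using less[of "n - 1"] height_nonneg[OF v(1)] by (simp add: of_nat_diff)
      qed simp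
      then have "inflow u w = 0" by (simp add: inflow_def)
      then show ?thesis using inflow_eq[OF w(1)] \<mu> by simp
    qed
    then show ?case by blast
  qed
  from this[of "nat (height G v)"] assms height_nonneg[OF assms] show ?thesis by simp
qed

end

section \<open>Uniqueness of the stabilizing solution\<close>

lemma eigenvalue_smult:
  fixes A :: "'a::field mat"
  assumes A: "A \<in> carrier_mat n n" and c: "c \<noteq> 0" and ev: "eigenvalue (c \<cdot>\<^sub>m A) k"
  shows "eigenvalue A (k / c)"
proof -
  obtain v where v: "v \<in> carrier_vec n" "v \<noteq> 0\<^sub>v n" "(c \<cdot>\<^sub>m A) *\<^sub>v v = k \<cdot>\<^sub>v v"
    using ev A by (auto simp: eigenvalue_def eigenvector_def)
  have "A *\<^sub>v v = (k / c) \<cdot>\<^sub>v v"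
  proof (rule eq_vecI)
    fix i assume i: "i < dim_vec ((k / c) \<cdot>\<^sub>v v)"
    with v(1) have i: "i < n" by simp
    have "((c \<cdot>\<^sub>m A) *\<^sub>v v) $ i = c * (A *\<^sub>v v) $ i"
      using A v(1) i by (simp add: scalar_prod_def sum_distrib_left mult.assoc)
    then show "(A *\<^sub>v v) $ i = ((k / c) \<cdot>\<^sub>v v) $ i"
      unfolding v(3) using v(1) i c by (simp add: field_simps)
  qed (use A v in auto)
  then show ?thesis
    using v A by (auto simp: eigenvalue_def eigenvector_def)
qed

lemma smult_pow_mat:
  fixes A :: "'a::comm_semiring_1 mat"
  assumes A: "A \<in> carrier_mat n n"
  shows "(c \<cdot>\<^sub>m A) ^\<^sub>m k = c ^ k \<cdot>\<^sub>m A ^\<^sub>m k"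
proof (induction k)
  case 0
  then show ?case using A by (intro eq_matI) auto
next
  case (Suc k)
  have Ak: "A ^\<^sub>m k \<in> carrier_mat n n" using A by (rule pow_carrier_mat)
  have "(c ^ k \<cdot>\<^sub>m A ^\<^sub>m k) * (c \<cdot>\<^sub>m A) = c ^ k \<cdot>\<^sub>m (c \<cdot>\<^sub>m (A ^\<^sub>m k * A))"
    using mult_smult_assoc_mat[OF Ak, of "c \<cdot>\<^sub>m A" n "c ^ k"] mult_smult_distrib[OF Ak A, of c] A
    by simp
  also have "\<dots> = c ^ Suc k \<cdot>\<^sub>m (A ^\<^sub>m k * A)"
    using A Ak by (intro eq_matI) (auto simp: mult_ac)
  finally show ?case by (simp add: Suc)
qed

text \<open>
  Dividing by a number \<open>r\<close> strictly between the spectral radius and one leaves the spectral radius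
  below one, so the powers stay bounded; undoing the scaling gives geometric decay.
\<close>

lemma powers_decay:
  fixes A :: "real mat"
  assumes A: "A \<in> carrier_mat n n" and n: "0 < n"
    and stable: "\<And>z. eigenvalue (map_mat complex_of_real A) z \<Longrightarrow> cmod z < 1"
  obtains c r where "0 < r" "r < 1" "\<And>k i j. i < n \<Longrightarrow> j < n \<Longrightarrow> \<bar>(A ^\<^sub>m k) $$ (i, j)\<bar> \<le> c * r ^ k"
proof -
  let ?A = "map_mat complex_of_real A"
  have cA: "?A \<in> carrier_mat n n" using A by simp
  obtain l where l: "l \<in> spectrum ?A" "spectral_radius ?A = cmod l"
    using spectral_radius_mem_max(1)[OF cA n] by auto
  then have "spectral_radius ?A < 1" "0 \<le> spectral_radius ?A"
    using stable by (auto simp: spectrum_def)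
  then obtain r where r: "spectral_radius ?A < r" "0 < r" "r < 1"
    by (meson dense order_le_less_trans)
  define B where "B = complex_of_real (1 / r) \<cdot>\<^sub>m ?A"
  have cB: "B \<in> carrier_mat n n" using cA by (simp add: B_def)
  have "spectral_radius B < 1"
  proof -
    obtain k where k: "eigenvalue B k" "spectral_radius B = cmod k"
      using spectral_radius_mem_max(1)[OF cB n] by (auto simp: spectrum_def)
    have "eigenvalue ?A (k / complex_of_real (1 / r))"
      by (rule eigenvalue_smult[OF cA]) (use k r in \<open>auto simp: B_def\<close>)
    then have "cmod (k / complex_of_real (1 / r)) \<le> spectral_radius ?A"
      by (intro spectral_radius_mem_max(2)[OF cA n]) (auto simp: spectrum_def)
    then have "cmod k * r \<le> spectral_radius ?A"
      using r by (simp add: norm_mult norm_divide)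
    then have "cmod k * r < 1 * r" using r by linarith
    then show ?thesis using r k by simp
  qed
  from spectral_radius_jnf_norm_bound_less_1_upper_triangular[OF cB this]
  obtain c where c: "\<And>k. norm_bound (B ^\<^sub>m k) c" by blast
  have "\<bar>(A ^\<^sub>m k) $$ (i, j)\<bar> \<le> c * r ^ k" if ij: "i < n" "j < n" for k i j
  proof -
    have Ak: "A ^\<^sub>m k \<in> carrier_mat n n" using A by (rule pow_carrier_mat)
    have "map_mat complex_of_real (A ^\<^sub>m k) = ?A ^\<^sub>m k"
      by (rule of_real_hom.mat_hom_pow[OF A])
    then have "B ^\<^sub>m k = complex_of_real (1 / r) ^ k \<cdot>\<^sub>m map_mat complex_of_real (A ^\<^sub>m k)"
      unfolding B_def using smult_pow_mat[OF cA] by simp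
    then have "(B ^\<^sub>m k) $$ (i, j) = complex_of_real ((1 / r) ^ k * (A ^\<^sub>m k) $$ (i, j))"
      using ij carrier_matD[OF Ak] by (simp del: pow_mat_dim pow_mat_dim_square)
    then have "cmod ((B ^\<^sub>m k) $$ (i, j)) = (1 / r) ^ k * \<bar>(A ^\<^sub>m k) $$ (i, j)\<bar>"
      using r by (simp only: norm_of_real abs_mult) simp
    moreover have "cmod ((B ^\<^sub>m k) $$ (i, j)) \<le> c"
      using c[of k] ij cB by (simp add: norm_bound_def pow_mat_dim_square[OF cB])
    ultimately have "(1 / r) ^ k * \<bar>(A ^\<^sub>m k) $$ (i, j)\<bar> \<le> c" by simp
    then show ?thesis using r by (simp add: power_divide field_simps)
  qed
  with r that show thesis by blast
qed

text \<open>
  Iterating a Stein equation puts \<open>k\<close>th powers of the coefficients around the unknown, so decaying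
  powers force it to vanish.
\<close>

lemma stein_equation_powers:
  fixes A B X :: "real mat"
  assumes A: "A \<in> carrier_mat n n" and B: "B \<in> carrier_mat n n" and X: "X \<in> carrier_mat n n"
    and eq: "X = transpose_mat A * X * B"
  shows "X = transpose_mat (A ^\<^sub>m k) * X * (B ^\<^sub>m k)"
proof (induction k)
  case 0
  then show ?case using A B X by simp
next
  case (Suc k)
  have [simp]: "A ^\<^sub>m k \<in> carrier_mat n n" "B ^\<^sub>m k \<in> carrier_mat n n"
    using A B by (auto intro: pow_carrier_mat)
  let ?P = "transpose_mat (A ^\<^sub>m k)"
  have "X = transpose_mat A * (?P * X * (B ^\<^sub>m k)) * B"
    using eq Suc by simp
  also have "\<dots> = transpose_mat A * (?P * X) * (B ^\<^sub>m k) * B"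
    using A X by (subst assoc_mult_mat[of "transpose_mat A" n n "?P * X" n "B ^\<^sub>m k" n]) auto
  also have "\<dots> = transpose_mat A * (?P * X) * ((B ^\<^sub>m k) * B)"
    using A B X by (intro assoc_mult_mat[of _ n n _ n _ n]) auto
  also have "transpose_mat A * (?P * X) = transpose_mat A * ?P * X"
    using A X by (intro assoc_mult_mat[symmetric, of _ n n _ n _ n]) auto
  also have "transpose_mat A * ?P = transpose_mat (A ^\<^sub>m Suc k)"
    using A by (simp add: transpose_mult[of _ n n _ n])
  finally show ?case by simp
qed

lemma stein_equation_zero:
  fixes A B X :: "real mat"
  assumes A: "A \<in> carrier_mat n n" and B: "B \<in> carrier_mat n n" and X: "X \<in> carrier_mat n n"
    and eq: "X = transpose_mat A * X * B"
    and stable_A: "\<And>z. eigenvalue (map_mat complex_of_real A) z \<Longrightarrow> cmod z < 1"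
    and stable_B: "\<And>z. eigenvalue (map_mat complex_of_real B) z \<Longrightarrow> cmod z < 1"
  shows "X = 0\<^sub>m n n"
proof (cases "n = 0")
  case True
  then show ?thesis using X by (intro eq_matI) auto
next
  case False
  then have n: "0 < n" by simp
  obtain a r where r: "0 < r" "r < 1" and a: "\<And>k i j. i < n \<Longrightarrow> j < n \<Longrightarrow> \<bar>(A ^\<^sub>m k) $$ (i, j)\<bar> \<le> a * r ^ k"
    using powers_decay[OF A n stable_A] by metis
  obtain b s where s: "0 < s" "s < 1" and b: "\<And>k i j. i < n \<Longrightarrow> j < n \<Longrightarrow> \<bar>(B ^\<^sub>m k) $$ (i, j)\<bar> \<le> b * s ^ k"
    using powers_decay[OF B n stable_B] by metis
  obtain x where x: "norm_bound X x" using norm_bound_max by blast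
  define c where "c = a * x * real n * b * real n"
  have bound: "\<bar>X $$ (i, j)\<bar> \<le> c * (r * s) ^ k" if ij: "i < n" "j < n" for i j k
  proof -
    have Ak: "A ^\<^sub>m k \<in> carrier_mat n n" and Bk: "B ^\<^sub>m k \<in> carrier_mat n n"
      using A B by (auto intro: pow_carrier_mat)
    have At: "transpose_mat (A ^\<^sub>m k) \<in> carrier_mat n n" using Ak by simp
    have "norm_bound (transpose_mat (A ^\<^sub>m k)) (a * r ^ k)"
      using a[of _ _ k] carrier_matD[OF Ak]
      by (auto simp: norm_bound_def simp del: pow_mat_dim pow_mat_dim_square)
    then have "norm_bound (transpose_mat (A ^\<^sub>m k) * X) (a * r ^ k * x * real n)"
      using x by (rule norm_bound_mult[OF At X])
    moreover have "norm_bound (B ^\<^sub>m k) (b * s ^ k)"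
      using b[of _ _ k] carrier_matD[OF Bk]
      by (auto simp: norm_bound_def simp del: pow_mat_dim pow_mat_dim_square)
    ultimately have "norm_bound (transpose_mat (A ^\<^sub>m k) * X * (B ^\<^sub>m k))
        (a * r ^ k * x * real n * (b * s ^ k) * real n)"
      by (rule norm_bound_mult[OF mult_carrier_mat[OF At X] Bk])
    then have "norm_bound X (a * r ^ k * x * real n * (b * s ^ k) * real n)"
      using stein_equation_powers[OF A B X eq, of k] by simp
    then show ?thesis
      using ij X by (simp add: norm_bound_def c_def power_mult_distrib mult_ac)
  qed
  have "r * s < 1" "0 < r * s"
    using mult_strict_mono[of r 1 s 1] r s by simp_all
  then have "(\<lambda>k. c * (r * s) ^ k) \<longlonglongrightarrow> c * 0"
    by (intro tendsto_mult tendsto_const LIMSEQ_power_zero) simp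
  then have "\<bar>X $$ (i, j)\<bar> \<le> c * 0" if "i < n" "j < n" for i j
    by (rule LIMSEQ_le_const) (use bound[OF that] in blast)
  then show ?thesis using X by (intro eq_matI) auto
qed

lemma transpose_cross_term:
  fixes S C H :: "real mat"
  assumes S: "S \<in> carrier_mat n m" and C: "C \<in> carrier_mat n m" and H: "H \<in> carrier_mat n n"
    and sym: "transpose_mat H = H"
  shows "transpose_mat (- S + \<beta> \<cdot>\<^sub>m (H * C))
    = - transpose_mat S + \<beta> \<cdot>\<^sub>m (transpose_mat C * H)"
proof -
  have "transpose_mat (- S + \<beta> \<cdot>\<^sub>m (H * C)) = - transpose_mat S + \<beta> \<cdot>\<^sub>m transpose_mat (H * C)"
    by (intro eq_matI) (use carrier_matD[OF S] carrier_matD[OF C] carrier_matD[OF H] in auto)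
  also have "transpose_mat (H * C) = transpose_mat C * H"
    using transpose_mult[OF H C] sym by simp
  finally show ?thesis .
qed

text \<open>
  The residual \<open>I + S F\<close> and the closed loop \<open>I - C F\<close> of the feedback given by \<open>D F = N\<^sup>T\<close> satisfy
  \<open>S\<^sup>T (I + S F) = \<beta> C\<^sup>T H (I - C F)\<close>.  This cancels all terms that contain \<open>K\<close>, so the identity
  holds for every second feedback \<open>K\<close> and not only for \<open>K = F\<close>.
\<close>

lemma riccati_two_feedbacks:
  fixes S C H F K :: "real mat"
  assumes S: "S \<in> carrier_mat n m" and C: "C \<in> carrier_mat n m" and H: "H \<in> carrier_mat n n"
    and F: "F \<in> carrier_mat m n" and K: "K \<in> carrier_mat m n"
    and sym: "transpose_mat H = H"
    and feedback: "(transpose_mat S * S + \<beta> \<cdot>\<^sub>m (transpose_mat C * H * C)) * F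
      = transpose_mat (- S + \<beta> \<cdot>\<^sub>m (H * C))"
    and dare: "H = 1\<^sub>m n + \<beta> \<cdot>\<^sub>m H - (- S + \<beta> \<cdot>\<^sub>m (H * C)) * F"
  shows "H = transpose_mat (1\<^sub>m n - C * K) * (\<beta> \<cdot>\<^sub>m (H * (1\<^sub>m n - C * F)))
    + transpose_mat (1\<^sub>m n + S * K) * (1\<^sub>m n + S * F)"
proof -
  let ?Y = "1\<^sub>m n + S * F" and ?M = "1\<^sub>m n - C * F"
  let ?St = "transpose_mat S" and ?Ct = "transpose_mat C" and ?Kt = "transpose_mat K"
  have [simp]: "S \<in> carrier_mat n m" "C \<in> carrier_mat n m" "H \<in> carrier_mat n n"
    "F \<in> carrier_mat m n" "K \<in> carrier_mat m n" by fact+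
  have [simp]: "C * F \<in> carrier_mat n n" "S * F \<in> carrier_mat n n"
    "C * K \<in> carrier_mat n n" "S * K \<in> carrier_mat n n" "H * C \<in> carrier_mat n m"
    using mult_carrier_mat[OF C F] mult_carrier_mat[OF S F] mult_carrier_mat[OF C K]
      mult_carrier_mat[OF S K] mult_carrier_mat[OF H C] by auto
  have StC[simp]: "?St \<in> carrier_mat m n" "?Ct \<in> carrier_mat m n" by simp_all
  have [simp]: "?St * S \<in> carrier_mat m m" "?Ct * H \<in> carrier_mat m n" "?Ct * H * C \<in> carrier_mat m m"
    using mult_carrier_mat[OF StC(1) S] mult_carrier_mat[OF StC(2) H]
      mult_carrier_mat[OF mult_carrier_mat[OF StC(2) H] C] by auto
  have Kt: "?Kt \<in> carrier_mat n m" by simp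
  define P where "P = \<beta> \<cdot>\<^sub>m (H * ?M)"
  have P[simp]: "P \<in> carrier_mat n n" unfolding P_def by (intro smult_carrier_mat mult_carrier_mat[of H n n] minus_carrier_mat) auto
  have Y[simp]: "?Y \<in> carrier_mat n n" by simp
  have HM: "H * ?M = H - H * (C * F)"
    by (simp add: mult_minus_distrib_mat[of H n n "1\<^sub>m n" n "C * F"] right_mult_one_mat[OF H])
  note t = transpose_cross_term[OF S C H sym]
  have D: "(?St * S + \<beta> \<cdot>\<^sub>m (?Ct * H * C)) * F = ?St * (S * F) + \<beta> \<cdot>\<^sub>m (?Ct * (H * (C * F)))"
  proof -
    have "(?St * S + \<beta> \<cdot>\<^sub>m (?Ct * H * C)) * F = ?St * S * F + \<beta> \<cdot>\<^sub>m (?Ct * H * C) * F"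
      by (rule add_mult_distrib_mat[of _ m m _ _ n]) auto
    also have "\<beta> \<cdot>\<^sub>m (?Ct * H * C) * F = \<beta> \<cdot>\<^sub>m (?Ct * H * C * F)"
      by (rule mult_smult_assoc_mat[of _ m m _ n]) auto
    also have "?St * S * F = ?St * (S * F)"
      by (rule assoc_mult_mat[of _ m n _ m _ n]) auto
    also have "?Ct * H * C * F = ?Ct * H * (C * F)"
      by (rule assoc_mult_mat[of _ m n _ m _ n]) auto
    also have "\<dots> = ?Ct * (H * (C * F))"
      by (rule assoc_mult_mat[of _ m n _ n _ n]) auto
    finally show ?thesis .
  qed
  have stationary: "?St * ?Y = ?Ct * P"
  proof -
    have L: "?St * ?Y = ?St + ?St * (S * F)"
      by (simp add: mult_add_distrib_mat[of ?St m n "1\<^sub>m n" n "S * F"]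
          right_mult_one_mat[of ?St m n])
    have R: "?Ct * P = \<beta> \<cdot>\<^sub>m (?Ct * H - ?Ct * (H * (C * F)))"
    proof -
      have HCF: "H * (C * F) \<in> carrier_mat n n"
        by (rule mult_carrier_mat[OF H]) simp
      have "?Ct * (\<beta> \<cdot>\<^sub>m (H - H * (C * F))) = \<beta> \<cdot>\<^sub>m (?Ct * (H - H * (C * F)))"
        by (rule mult_smult_distrib[OF StC(2) minus_carrier_mat[OF HCF]])
      also have "?Ct * (H - H * (C * F)) = ?Ct * H - ?Ct * (H * (C * F))"
        by (rule mult_minus_distrib_mat[OF StC(2) H HCF])
      finally show ?thesis unfolding P_def HM .
    qed
    have eq: "?St * (S * F) + \<beta> \<cdot>\<^sub>m (?Ct * (H * (C * F))) = - ?St + \<beta> \<cdot>\<^sub>m (?Ct * H)"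
      using feedback D t by simp
    define P1 P2 P3 where "P1 = ?St * (S * F)" and "P2 = ?Ct * (H * (C * F))" and "P3 = ?Ct * H"
    have cP: "P1 \<in> carrier_mat m n" "P2 \<in> carrier_mat m n" "P3 \<in> carrier_mat m n"
      unfolding P1_def P2_def P3_def
      by (auto intro!: mult_carrier_mat[OF StC(1)] mult_carrier_mat[OF StC(2)] mult_carrier_mat[OF H])
    have entry: "P1 $$ (i, j) + \<beta> * P2 $$ (i, j) = - (?St $$ (i, j)) + \<beta> * P3 $$ (i, j)"
      if "i < m" "j < n" for i j
      using arg_cong[OF eq[folded P1_def P2_def P3_def], of "\<lambda>M. M $$ (i, j)"] that cP carrier_matD[OF S] by simp
    show ?thesis
      unfolding L R P1_def[symmetric] P2_def[symmetric] P3_def[symmetric]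
      by (rule eq_matI) (use entry cP carrier_matD[OF S] in \<open>auto simp: algebra_simps\<close>)
  qed
  have HYP: "H = ?Y + P"
  proof -
    have "(- S + \<beta> \<cdot>\<^sub>m (H * C)) * F = (- S) * F + \<beta> \<cdot>\<^sub>m (H * C) * F"
      by (rule add_mult_distrib_mat[of _ n m _ _ n]) auto
    also have "\<beta> \<cdot>\<^sub>m (H * C) * F = \<beta> \<cdot>\<^sub>m (H * C * F)"
      by (rule mult_smult_assoc_mat[of _ n m _ n]) auto
    also have "H * C * F = H * (C * F)"
      by (rule assoc_mult_mat[of _ n n _ m _ n]) auto
    also have "(- S) * F = - (S * F)"
      by (rule uminus_mult_left_mat) (use carrier_matD[OF S] carrier_matD[OF F] in simp)
    finally have NF: "(- S + \<beta> \<cdot>\<^sub>m (H * C)) * F = - (S * F) + \<beta> \<cdot>\<^sub>m (H * (C * F))" .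
    define P1 P2 where "P1 = S * F" and "P2 = H * (C * F)"
    have cP: "P1 \<in> carrier_mat n n" "P2 \<in> carrier_mat n n"
      unfolding P1_def P2_def by (auto intro!: mult_carrier_mat[OF H])
    have entry: "H $$ (i, j) = (1\<^sub>m n :: real mat) $$ (i, j) + \<beta> * H $$ (i, j)
        - (- P1 $$ (i, j) + \<beta> * P2 $$ (i, j))" if "i < n" "j < n" for i j
      using arg_cong[OF dare[unfolded NF, folded P1_def P2_def], of "\<lambda>M. M $$ (i, j)"] that cP carrier_matD[OF H]
      by simp
    show ?thesis
      unfolding P_def HM P1_def[symmetric] P2_def[symmetric]
      by (rule eq_matI) (use entry cP carrier_matD[OF H] in \<open>auto simp: algebra_simps\<close>)
  qed
  have MK: "transpose_mat (1\<^sub>m n - C * K) = 1\<^sub>m n - ?Kt * ?Ct"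
    by (simp add: transpose_minus[of _ n n] transpose_mult[of C n m K n])
  have YK: "transpose_mat (1\<^sub>m n + S * K) = 1\<^sub>m n + ?Kt * ?St"
    by (simp add: transpose_add[of _ n n] transpose_mult[of S n m K n])
  have "transpose_mat (1\<^sub>m n - C * K) * P = P - ?Kt * (?Ct * P)"
    unfolding MK minus_mult_distrib_mat[OF one_carrier_mat mult_carrier_mat[OF Kt StC(2)] P]
      assoc_mult_mat[OF Kt StC(2) P] left_mult_one_mat[OF P] ..
  moreover have "transpose_mat (1\<^sub>m n + S * K) * ?Y = ?Y + ?Kt * (?St * ?Y)"
    unfolding YK add_mult_distrib_mat[OF one_carrier_mat mult_carrier_mat[OF Kt StC(1)] Y]
      assoc_mult_mat[OF Kt StC(1) Y] left_mult_one_mat[OF Y] ..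
  moreover have cancel: "(A - B) + (E + B) = E + A"
    if "A \<in> carrier_mat n n" "B \<in> carrier_mat n n" "E \<in> carrier_mat n n" for A B E :: "real mat"
    by (rule eq_matI) (use that in auto)
  moreover have Q: "?Kt * (?Ct * P) \<in> carrier_mat n n"
    by (rule mult_carrier_mat[OF Kt mult_carrier_mat[OF StC(2) P]])
  ultimately have total: "transpose_mat (1\<^sub>m n - C * K) * P + transpose_mat (1\<^sub>m n + S * K) * ?Y = ?Y + P"
    unfolding stationary by (simp only: cancel[OF P Q Y])
  show ?thesis
    unfolding P_def[symmetric] by (rule trans[OF HYP total[symmetric]])
qed

lemma inv_mat_inverts:
  assumes A: "A \<in> carrier_mat n n" and inv: "invertible_mat A"
  shows "inv_mat A \<in> carrier_mat n n" "A * inv_mat A = 1\<^sub>m n" "inv_mat A * A = 1\<^sub>m n"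
proof -
  from inv obtain B where B: "A * B = 1\<^sub>m (dim_row A)" "B * A = 1\<^sub>m (dim_row B)"
    unfolding invertible_mat_def inverts_mat_def by blast
  have "dim_row B = n"
    using arg_cong[OF B(2), of dim_col] A by simp
  moreover have "dim_col B = n"
    using arg_cong[OF B(1), of dim_col] A by simp
  ultimately have "A \<in> Units (ring_mat TYPE(real) n ())"
    using A B by (auto simp: Units_def ring_mat_simps intro!: bexI[of _ B])
  then obtain E where "mat_inverse A = Some E"
    using mat_inverse(1)[OF A, where b = "()"] by blast
  then show "inv_mat A \<in> carrier_mat n n" "A * inv_mat A = 1\<^sub>m n" "inv_mat A * A = 1\<^sub>m n"
    using mat_inverse(2)[OF A] by (auto simp: inv_mat_def)
qed

lemma graph_mats_carrier:
  shows sender_mat_carrier: "sender_mat G \<in> carrier_mat (card (verts G)) (card (arcs G))"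
    and receiver_mat_carrier: "receiver_mat G \<in> carrier_mat (card (verts G)) (card (arcs G))"
    and C_mat_carrier: "C_mat G \<in> carrier_mat (card (verts G)) (card (arcs G))"
proof -
  have cols: "mat_of_cols n (map f [0..<m]) \<in> carrier_mat n m" for n m f
    using mat_of_cols_carrier(1)[of n "map f [0..<m]"] by simp
  show S: "sender_mat G \<in> carrier_mat (card (verts G)) (card (arcs G))"
    and "receiver_mat G \<in> carrier_mat (card (verts G)) (card (arcs G))"
    unfolding sender_mat_def receiver_mat_def Let_def by (rule cols)+
  show "C_mat G \<in> carrier_mat (card (verts G)) (card (arcs G))"
    unfolding C_mat_def by (rule minus_carrier_mat[OF S])
qed

lemma D_N_mat_carrier:
  assumes H: "H \<in> carrier_mat (card (verts G)) (card (verts G))"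
  shows "D_mat G \<beta> H \<in> carrier_mat (card (arcs G)) (card (arcs G))"
    and "N_mat G \<beta> H \<in> carrier_mat (card (verts G)) (card (arcs G))"
proof -
  have Ct: "transpose_mat (C_mat G) \<in> carrier_mat (card (arcs G)) (card (verts G))"
    using C_mat_carrier[of G] by simp
  show "D_mat G \<beta> H \<in> carrier_mat (card (arcs G)) (card (arcs G))"
    unfolding D_mat_def
    by (rule add_carrier_mat smult_carrier_mat mult_carrier_mat[OF mult_carrier_mat[OF Ct H] C_mat_carrier])+
  show "N_mat G \<beta> H \<in> carrier_mat (card (verts G)) (card (arcs G))"
    unfolding N_mat_def
    by (rule add_carrier_mat smult_carrier_mat mult_carrier_mat[OF H C_mat_carrier])+
qed

definition feedback_mat :: "(nat, nat) pre_digraph \<Rightarrow> real \<Rightarrow> real mat \<Rightarrow> real mat" where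
  "feedback_mat G \<beta> H = inv_mat (D_mat G \<beta> H) * transpose_mat (N_mat G \<beta> H)"

lemma feedback_mat:
  assumes H: "H \<in> carrier_mat (card (verts G)) (card (verts G))"
    and inv: "invertible_mat (D_mat G \<beta> H)"
  shows "feedback_mat G \<beta> H \<in> carrier_mat (card (arcs G)) (card (verts G))"
    and "D_mat G \<beta> H * feedback_mat G \<beta> H = transpose_mat (N_mat G \<beta> H)"
    and "N_mat G \<beta> H * inv_mat (D_mat G \<beta> H) * transpose_mat (N_mat G \<beta> H)
      = N_mat G \<beta> H * feedback_mat G \<beta> H"
    and "closed_loop_mat G \<beta> H
      = sqrt \<beta> \<cdot>\<^sub>m (1\<^sub>m (card (verts G)) - C_mat G * feedback_mat G \<beta> H)"
proof -
  note D = D_N_mat_carrier(1)[OF H, of \<beta>] and N = D_N_mat_carrier(2)[OF H, of \<beta>]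
  note I = inv_mat_inverts[OF D inv]
  have Nt: "transpose_mat (N_mat G \<beta> H) \<in> carrier_mat (card (arcs G)) (card (verts G))"
    using N by simp
  show "feedback_mat G \<beta> H \<in> carrier_mat (card (arcs G)) (card (verts G))"
    unfolding feedback_mat_def by (rule mult_carrier_mat[OF I(1) Nt])
  show "D_mat G \<beta> H * feedback_mat G \<beta> H = transpose_mat (N_mat G \<beta> H)"
    unfolding feedback_mat_def assoc_mult_mat[OF D I(1) Nt, symmetric] I(2)
    by (rule left_mult_one_mat[OF Nt])
  show "N_mat G \<beta> H * inv_mat (D_mat G \<beta> H) * transpose_mat (N_mat G \<beta> H)
      = N_mat G \<beta> H * feedback_mat G \<beta> H"
    unfolding feedback_mat_def by (rule assoc_mult_mat[OF N I(1) Nt])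
  show "closed_loop_mat G \<beta> H
      = sqrt \<beta> \<cdot>\<^sub>m (1\<^sub>m (card (verts G)) - C_mat G * feedback_mat G \<beta> H)"
    unfolding feedback_mat_def closed_loop_mat_def
      assoc_mult_mat[OF C_mat_carrier I(1) Nt] ..
qed

text \<open>
  In the identity above, take one solution with the feedback of the other as \<open>K\<close>, then exchange
  their roles and transpose.  The residual terms agree, so the difference of the solutions satisfies
  a Stein equation whose coefficients are the two closed loops.
\<close>

lemma stabilizing_solution_unique:
  assumes \<beta>: "0 < \<beta>"
    and H: "reduced_dare_solution G \<beta> H" "stabilizing G \<beta> H"
    and H': "reduced_dare_solution G \<beta> H'" "stabilizing G \<beta> H'"
  shows "H = H'"
proof -
  define n m where "n = card (verts G)" and "m = card (arcs G)"
  define S C where "S = sender_mat G" and "C = C_mat G"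
  have S: "S \<in> carrier_mat n m" and C: "C \<in> carrier_mat n m"
    unfolding S_def C_def n_def m_def by (rule sender_mat_carrier C_mat_carrier)+
  note sol = H(1)[unfolded reduced_dare_solution_def Let_def, folded n_def]
  note sol' = H'(1)[unfolded reduced_dare_solution_def Let_def, folded n_def]
  note cH = sol[THEN conjunct1] sol'[THEN conjunct1]
  note sym = sol[THEN conjunct2, THEN conjunct1] sol'[THEN conjunct2, THEN conjunct1]
  note inv = sol[THEN conjunct2, THEN conjunct2, THEN conjunct1]
    sol'[THEN conjunct2, THEN conjunct2, THEN conjunct1]
  define F F' where "F = feedback_mat G \<beta> H" and "F' = feedback_mat G \<beta> H'"
  note f = feedback_mat[OF cH(1)[unfolded n_def] inv(1), folded n_def m_def F_def C_def]
  note f' = feedback_mat[OF cH(2)[unfolded n_def] inv(2), folded n_def m_def F'_def C_def]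
  define M M' where "M = 1\<^sub>m n - C * F" and "M' = 1\<^sub>m n - C * F'"
  define Y Y' where "Y = 1\<^sub>m n + S * F" and "Y' = 1\<^sub>m n + S * F'"
  have cM: "M \<in> carrier_mat n n" "M' \<in> carrier_mat n n"
    unfolding M_def M'_def by (intro minus_carrier_mat mult_carrier_mat[OF C] f(1) f'(1))+
  have cY: "Y \<in> carrier_mat n n" "Y' \<in> carrier_mat n n"
    unfolding Y_def Y'_def by (intro add_carrier_mat mult_carrier_mat[OF S] f(1) f'(1))+
  note dare = sol[THEN conjunct2, THEN conjunct2, THEN conjunct2, unfolded f(3)]
    sol'[THEN conjunct2, THEN conjunct2, THEN conjunct2, unfolded f'(3)]
  have eq: "H = transpose_mat M' * (\<beta> \<cdot>\<^sub>m (H * M)) + transpose_mat Y' * Y"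
    unfolding M_def M'_def Y_def Y'_def
    by (rule riccati_two_feedbacks[OF S C cH(1) f(1) f'(1) sym(1)
          f(2)[unfolded D_mat_def N_mat_def, folded S_def C_def]
          dare(1)[unfolded N_mat_def, folded S_def C_def]])
  have eq': "H' = transpose_mat M * (\<beta> \<cdot>\<^sub>m (H' * M')) + transpose_mat Y * Y'"
    unfolding M_def M'_def Y_def Y'_def
    by (rule riccati_two_feedbacks[OF S C cH(2) f'(1) f(1) sym(2)
          f'(2)[unfolded D_mat_def N_mat_def, folded S_def C_def]
          dare(2)[unfolded N_mat_def, folded S_def C_def]])
  let ?A = "sqrt \<beta> \<cdot>\<^sub>m M'" and ?B = "sqrt \<beta> \<cdot>\<^sub>m M" and ?X = "H - H'"
  have cMt: "transpose_mat M' \<in> carrier_mat n n" "transpose_mat M \<in> carrier_mat n n"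
    using cM by auto
  have cHM: "H * M \<in> carrier_mat n n" "H' * M \<in> carrier_mat n n" "H' * M' \<in> carrier_mat n n"
    using cH cM by auto
  have p1: "transpose_mat M' * (\<beta> \<cdot>\<^sub>m (H * M)) = \<beta> \<cdot>\<^sub>m (transpose_mat M' * (H * M))"
    by (rule mult_smult_distrib[OF cMt(1) cHM(1)])
  have p2: "transpose_mat (transpose_mat M * (\<beta> \<cdot>\<^sub>m (H' * M')))
      = \<beta> \<cdot>\<^sub>m (transpose_mat M' * (H' * M))"
  proof -
    have "transpose_mat (transpose_mat M * (\<beta> \<cdot>\<^sub>m (H' * M')))
        = transpose_mat (\<beta> \<cdot>\<^sub>m (transpose_mat M * (H' * M')))"
      by (simp only: mult_smult_distrib[OF cMt(2) cHM(3)])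
    also have "\<dots> = \<beta> \<cdot>\<^sub>m transpose_mat (transpose_mat M * (H' * M'))"
      by (rule eq_matI) auto
    also have "transpose_mat (transpose_mat M * (H' * M')) = transpose_mat M' * H' * M"
      using transpose_mult[OF cMt(2) cHM(3)] transpose_mult[OF cH(2) cM(2)] sym(2) by simp
    also have "\<dots> = transpose_mat M' * (H' * M)"
      by (rule assoc_mult_mat[OF cMt(1) cH(2) cM(1)])
    finally show ?thesis .
  qed
  have "H' = transpose_mat (transpose_mat M * (\<beta> \<cdot>\<^sub>m (H' * M')) + transpose_mat Y * Y')"
    using arg_cong[OF eq', of transpose_mat] unfolding sym(2) .
  also have "\<dots> = transpose_mat (transpose_mat M * (\<beta> \<cdot>\<^sub>m (H' * M')))
      + transpose_mat (transpose_mat Y * Y')"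
    by (rule transpose_add[of _ n n]) (use cM cY cHM in auto)
  also have "transpose_mat (transpose_mat Y * Y') = transpose_mat Y' * Y"
    using transpose_mult[of "transpose_mat Y" n n Y' n] cY by simp
  finally have eq'': "H' = \<beta> \<cdot>\<^sub>m (transpose_mat M' * (H' * M)) + transpose_mat Y' * Y"
    unfolding p2 .
  have stein: "?X = transpose_mat ?A * ?X * ?B"
  proof -
    have At: "transpose_mat ?A = sqrt \<beta> \<cdot>\<^sub>m transpose_mat M'"
      by (rule eq_matI) auto
    have "sqrt \<beta> \<cdot>\<^sub>m transpose_mat M' * ?X * ?B = sqrt \<beta> \<cdot>\<^sub>m transpose_mat M' * (?X * ?B)"
      by (rule assoc_mult_mat[of _ n n _ n _ n]) (use cM cH in auto)
    also have "?X * ?B = sqrt \<beta> \<cdot>\<^sub>m (?X * M)"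
      by (rule mult_smult_distrib[of _ n n]) (use cM cH in auto)
    also have "?X * M = H * M - H' * M"
      by (rule minus_mult_distrib_mat[OF cH cM(1)])
    also have "sqrt \<beta> \<cdot>\<^sub>m transpose_mat M' * (sqrt \<beta> \<cdot>\<^sub>m (H * M - H' * M))
        = sqrt \<beta> \<cdot>\<^sub>m (sqrt \<beta> \<cdot>\<^sub>m (transpose_mat M' * (H * M - H' * M)))"
      by (simp only: mult_smult_distrib[OF cMt(1) minus_carrier_mat[OF cHM(2)]]
          mult_smult_assoc_mat[OF cMt(1) smult_carrier_mat[OF minus_carrier_mat[OF cHM(2)]]])
    also have "transpose_mat M' * (H * M - H' * M)
        = transpose_mat M' * (H * M) - transpose_mat M' * (H' * M)"
      by (rule mult_minus_distrib_mat[OF cMt(1) cHM(1,2)])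
    finally have rhs: "transpose_mat ?A * ?X * ?B = sqrt \<beta> \<cdot>\<^sub>m (sqrt \<beta> \<cdot>\<^sub>m
        (transpose_mat M' * (H * M) - transpose_mat M' * (H' * M)))"
      unfolding At .
    have diff: "?X = sqrt \<beta> \<cdot>\<^sub>m (sqrt \<beta> \<cdot>\<^sub>m (P - Q))"
      if "H = \<beta> \<cdot>\<^sub>m P + E" "H' = \<beta> \<cdot>\<^sub>m Q + E"
        "P \<in> carrier_mat n n" "Q \<in> carrier_mat n n" "E \<in> carrier_mat n n" for P Q E
    proof (rule eq_matI)
      fix i j
      assume "i < dim_row (sqrt \<beta> \<cdot>\<^sub>m (sqrt \<beta> \<cdot>\<^sub>m (P - Q)))"
        "j < dim_col (sqrt \<beta> \<cdot>\<^sub>m (sqrt \<beta> \<cdot>\<^sub>m (P - Q)))"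
      with that(4) have ij: "i < n" "j < n" by auto
      have "sqrt \<beta> * (sqrt \<beta> * (P $$ (i, j) - Q $$ (i, j))) = \<beta> * (P $$ (i, j) - Q $$ (i, j))"
        using \<beta> by (simp flip: mult.assoc)
      then show "?X $$ (i, j) = (sqrt \<beta> \<cdot>\<^sub>m (sqrt \<beta> \<cdot>\<^sub>m (P - Q))) $$ (i, j)"
        unfolding that(1,2) using ij that(3-5) by (simp add: algebra_simps)
    qed (use that(4) cH in auto)
    have "transpose_mat Y' * Y \<in> carrier_mat n n"
      by (rule mult_carrier_mat[of _ n n]) (use cY in auto)
    then show ?thesis
      unfolding rhs
      by (rule diff[OF eq[unfolded p1] eq'' mult_carrier_mat[OF cMt(1) cHM(1)]
          mult_carrier_mat[OF cMt(1) cHM(2)]])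
  qed
  have "?X = 0\<^sub>m n n"
    by (rule stein_equation_zero[OF _ _ _ stein])
      (use H(2) H'(2) cM cH f(4) f'(4) in \<open>auto simp: stabilizing_def M_def M'_def\<close>)
  then have "H $$ (i, j) = H' $$ (i, j)" if "i < n" "j < n" for i j
  proof -
    have "?X $$ (i, j) = 0" using \<open>?X = 0\<^sub>m n n\<close> that by simp
    moreover have "?X $$ (i, j) = H $$ (i, j) - H' $$ (i, j)"
      by (rule index_minus_mat) (use that cH in auto)
    ultimately show ?thesis by simp
  qed
  then show ?thesis using cH by (intro eq_matI) auto
qed

section \<open>Matrices acting on vector-valued functions\<close>

text \<open>
  The action is defined for functions with values in any real vector space, so that the same
  computation with the graph matrices serves real states and complex eigenvectors.
\<close>

definition act :: "real mat \<Rightarrow> (nat \<Rightarrow> 'k::real_vector) \<Rightarrow> nat \<Rightarrow> 'k" where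
  "act A x i = (\<Sum>j<dim_col A. A $$ (i, j) *\<^sub>R x j)"

lemma act_mult:
  assumes A: "A \<in> carrier_mat nr n" and B: "B \<in> carrier_mat n nc" and i: "i < nr"
  shows "act (A * B) x i = act A (act B x) i"
proof -
  have "act (A * B) x i = (\<Sum>j<nc. \<Sum>k<n. (A $$ (i, k) * B $$ (k, j)) *\<^sub>R x j)"
    unfolding act_def using carrier_matD[OF A] carrier_matD[OF B] i
    by (intro sum.cong) (auto simp: scalar_prod_def scaleR_sum_left atLeast0LessThan)
  also have "\<dots> = (\<Sum>k<n. \<Sum>j<nc. (A $$ (i, k) * B $$ (k, j)) *\<^sub>R x j)"
    by (rule sum.swap)
  also have "\<dots> = act A (act B x) i"
    unfolding act_def using carrier_matD[OF A] carrier_matD[OF B] by (simp add: scaleR_sum_right)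
  finally show ?thesis .
qed

lemma act_add:
  assumes "A \<in> carrier_mat nr nc" "B \<in> carrier_mat nr nc" "i < nr"
  shows "act (A + B) x i = act A x i + act B x i"
  using assms by (auto simp: act_def scaleR_left_distrib sum.distrib)

lemma act_minus:
  assumes "A \<in> carrier_mat nr nc" "B \<in> carrier_mat nr nc" "i < nr"
  shows "act (A - B) x i = act A x i - act B x i"
  using assms by (auto simp: act_def scaleR_left_diff_distrib sum_subtractf)

lemma act_uminus:
  assumes "A \<in> carrier_mat nr nc" "i < nr"
  shows "act (- A) x i = - act A x i"
  using assms by (auto simp: act_def sum_negf)

lemma act_smult:
  assumes "A \<in> carrier_mat nr nc" "i < nr"
  shows "act (c \<cdot>\<^sub>m A) x i = c *\<^sub>R act A x i"
  using assms by (auto simp: act_def scaleR_sum_right)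

lemma act_one: "i < n \<Longrightarrow> act (1\<^sub>m n) x i = x i"
  by (simp add: act_def if_distrib[of "\<lambda>c. c *\<^sub>R _"] sum.delta cong: if_cong)

lemma act_cong: "(\<And>j. j < dim_col A \<Longrightarrow> x j = y j) \<Longrightarrow> act A x i = act A y i"
  by (simp add: act_def)

lemma act_fun_uminus: "act A (\<lambda>j. - x j) i = - act A x i"
  by (simp add: act_def sum_negf)

lemma mat_eq_of_act_eq:
  assumes A: "A \<in> carrier_mat nr nc" and B: "B \<in> carrier_mat nr nc"
    and eq: "\<And>(x :: nat \<Rightarrow> real) i. i < nr \<Longrightarrow> act A x i = act B x i"
  shows "A = B"
proof (rule eq_matI)
  fix i j assume "i < dim_row B" "j < dim_col B"
  with B have i: "i < nr" and j: "j < nc" by auto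
  have "act M (\<lambda>k. if k = j then 1 else (0::real)) i = M $$ (i, j)" if "M \<in> carrier_mat nr nc" for M
    using that j by (simp add: act_def sum.delta if_distrib[of "\<lambda>c. _ * c"] cong: if_cong)
  from this[OF A] this[OF B] show "A $$ (i, j) = B $$ (i, j)"
    using eq[OF i] by simp
qed (use A B in auto)

lemma mult_mat_vec_eq_act:
  assumes "A \<in> carrier_mat nr nc" "v \<in> carrier_vec nc" "i < nr"
  shows "(A *\<^sub>v v) $ i = act A (\<lambda>j. v $ j) i"
  using assms by (auto simp: act_def scalar_prod_def atLeast0LessThan)

lemma complex_mult_mat_vec_eq_act:
  assumes "A \<in> carrier_mat nr nc" "v \<in> carrier_vec nc" "i < nr"
  shows "(map_mat complex_of_real A *\<^sub>v v) $ i = act A (\<lambda>j. v $ j) i"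
  using assms by (auto simp: act_def scalar_prod_def atLeast0LessThan scaleR_conv_of_real)

section \<open>The explicit solution\<close>

lemma index_finsum_mat:
  assumes fin: "finite A" and f: "\<And>a. a \<in> A \<Longrightarrow> f a \<in> carrier_mat nr nc"
    and ij: "i < nr" "j < nc"
  shows "finsum (module_mat TYPE(real) nr nc) f A $$ (i, j) = (\<Sum>a\<in>A. f a $$ (i, j))"
proof -
  interpret V: matrix_vs nr nc "TYPE(real)" .
  have "finsum V.V f A \<in> carrier_mat nr nc \<and> finsum V.V f A $$ (i, j) = (\<Sum>a\<in>A. f a $$ (i, j))"
    using fin f
  proof (induction A)
    case empty
    then show ?case using ij by simp
  next
    case (insert a A)
    then have f: "f \<in> A \<rightarrow> carrier_mat nr nc" "f a \<in> carrier_mat nr nc" by auto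
    have c: "finsum V.V f A \<in> carrier_mat nr nc" using insert by auto
    have "finsum V.V f (insert a A) = f a + finsum V.V f A"
      using V.finsum_insert[OF insert(1,2)] f by simp
    then show ?case
      using insert f c carrier_matD[OF c] carrier_matD[OF f(2)] ij by simp
  qed
  then show ?thesis by blast
qed

locale indexed_tree = oriented_tree G for G :: "(nat, nat) pre_digraph" +
  fixes N m :: nat and \<beta> :: real
  assumes verts: "verts G = {..<N}" and arcs: "arcs G = {..<m}"
    and \<beta>_pos: "0 < \<beta>" and \<beta>_less_1: "\<beta> < 1"
begin

lemma card_verts: "card (verts G) = N" and card_arcs: "card (arcs G) = m"
  by (simp_all add: verts arcs)

lemmas carriers = sender_mat_carrier[of G, unfolded card_verts card_arcs]
  receiver_mat_carrier[of G, unfolded card_verts card_arcs]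
  C_mat_carrier[of G, unfolded card_verts card_arcs]

lemma act_sender: "v < N \<Longrightarrow> act (sender_mat G) u v = outflow u v"
  and act_receiver: "v < N \<Longrightarrow> act (receiver_mat G) u v = inflow u v"
proof -
  assume v: "v < N"
  have "act (sender_mat G) u v = (\<Sum>e<m. if tail G e = v then u e else 0)"
    unfolding act_def carrier_matD[OF carriers(1)] using v
    by (intro sum.cong refl)
      (auto simp: sender_mat_def Let_def card_verts card_arcs mat_of_cols_index unit_vec_def)
  also have "\<dots> = (\<Sum>e\<in>{e \<in> {..<m}. tail G e = v}. u e)"
    by (rule sum.inter_filter[symmetric]) simp
  finally show "act (sender_mat G) u v = outflow u v"
    by (simp add: outflow_def out_arcs_def arcs)
  have "act (receiver_mat G) u v = (\<Sum>e<m. if head G e = v then u e else 0)"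
    unfolding act_def carrier_matD[OF carriers(2)] using v
    by (intro sum.cong refl)
      (auto simp: receiver_mat_def Let_def card_verts card_arcs mat_of_cols_index unit_vec_def)
  also have "\<dots> = (\<Sum>e\<in>{e \<in> {..<m}. head G e = v}. u e)"
    by (rule sum.inter_filter[symmetric]) simp
  finally show "act (receiver_mat G) u v = inflow u v"
    by (simp add: inflow_def in_arcs_def arcs)
qed

lemma ends_less: "e < m \<Longrightarrow> tail G e < N" "e < m \<Longrightarrow> head G e < N"
  using tail_in_verts[of e] head_in_verts[of e] by (auto simp: verts arcs)

lemma act_sender_transpose: "e < m \<Longrightarrow> act (transpose_mat (sender_mat G)) p e = p (tail G e)"
  and act_receiver_transpose: "e < m \<Longrightarrow> act (transpose_mat (receiver_mat G)) p e = p (head G e)"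
proof -
  assume e: "e < m"
  have "act (transpose_mat (sender_mat G)) p e = (\<Sum>v<N. if v = tail G e then p v else 0)"
    unfolding act_def index_transpose_mat carrier_matD[OF carriers(1)] using e carrier_matD[OF carriers(1)]
    by (intro sum.cong refl)
      (auto simp: sender_mat_def Let_def card_verts card_arcs mat_of_cols_index unit_vec_def)
  then show "act (transpose_mat (sender_mat G)) p e = p (tail G e)"
    using ends_less[OF e] by (simp add: sum.delta)
  have "act (transpose_mat (receiver_mat G)) p e = (\<Sum>v<N. if v = head G e then p v else 0)"
    unfolding act_def index_transpose_mat carrier_matD[OF carriers(2)] using e carrier_matD[OF carriers(2)]
    by (intro sum.cong refl)
      (auto simp: receiver_mat_def Let_def card_verts card_arcs mat_of_cols_index unit_vec_def)
  then show "act (transpose_mat (receiver_mat G)) p e = p (head G e)"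
    using ends_less[OF e] by (simp add: sum.delta)
qed

lemma act_C: "v < N \<Longrightarrow> act (C_mat G) u v = inflow u v - outflow u v"
  unfolding C_mat_def by (simp add: act_minus[OF carriers(2,1)] act_sender act_receiver)

lemma act_C_transpose: "e < m \<Longrightarrow> act (transpose_mat (C_mat G)) p e = p (head G e) - p (tail G e)"
proof -
  assume e: "e < m"
  have "transpose_mat (C_mat G) = transpose_mat (receiver_mat G) - transpose_mat (sender_mat G)"
    unfolding C_mat_def by (rule transpose_minus[OF carriers(2,1)])
  then show ?thesis
    using e carriers by (simp add: act_minus[of _ m N] act_sender_transpose act_receiver_transpose)
qed

definition solution :: "real mat" where
  "solution = q0 G \<beta> \<cdot>\<^sub>m self_outer (ones_vec N)
     + (\<Oplus>\<^bsub>real_mats N\<^esub>a\<in>{1..height_max G}.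
         \<Oplus>\<^bsub>real_mats N\<^esub>\<Omega>\<in>superlevel_components G a.
           kappa G \<beta> a \<Omega> \<cdot>\<^sub>m self_outer (indicator_vec N \<Omega>))"

lemma finite_superlevel_components: "finite (superlevel_components G a)"
  unfolding superlevel_components_eq
  using finite_subset[OF superlevel_subset finite_verts] by simp

lemma superlevel_component_verts: "\<Omega> \<in> superlevel_components G a \<Longrightarrow> \<Omega> \<subseteq> verts G"
  unfolding superlevel_components_eq using level_component_subset superlevel_subset by blast

lemma outer_carrier:
  "self_outer (ones_vec N) \<in> carrier_mat N N" "self_outer (indicator_vec N \<Omega>) \<in> carrier_mat N N"
  by (auto simp: self_outer_def ones_vec_def indicator_vec_def)

lemma level_sum_carrier:
  "(\<Oplus>\<^bsub>real_mats N\<^esub>\<Omega>\<in>superlevel_components G a.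
     kappa G \<beta> a \<Omega> \<cdot>\<^sub>m self_outer (indicator_vec N \<Omega>)) \<in> carrier_mat N N"
proof -
  interpret V: matrix_vs N N "TYPE(real)" .
  show ?thesis
    by (rule V.finsum_closed) (use outer_carrier in auto)
qed

lemma solution_carrier: "solution \<in> carrier_mat N N"
proof -
  interpret V: matrix_vs N N "TYPE(real)" .
  show ?thesis
    unfolding solution_def
    by (intro add_carrier_mat V.finsum_closed) (use level_sum_carrier in auto)
qed

lemma solution_index:
  assumes "i < N" "j < N"
  shows "solution $$ (i, j) = q0 G \<beta> + (\<Sum>a\<in>{1..height_max G}. \<Sum>\<Omega>\<in>superlevel_components G a.
    kappa G \<beta> a \<Omega> * (of_bool (i \<in> \<Omega>) * of_bool (j \<in> \<Omega>)))"
proof -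
  interpret V: matrix_vs N N "TYPE(real)" .
  have "(\<Oplus>\<^bsub>real_mats N\<^esub>a\<in>{1..height_max G}. \<Oplus>\<^bsub>real_mats N\<^esub>\<Omega>\<in>superlevel_components G a.
      kappa G \<beta> a \<Omega> \<cdot>\<^sub>m self_outer (indicator_vec N \<Omega>)) \<in> carrier_mat N N"
    by (rule V.finsum_closed) (use level_sum_carrier in auto)
  note c = this
  have "solution $$ (i, j) = q0 G \<beta> * self_outer (ones_vec N) $$ (i, j)
      + (\<Sum>a\<in>{1..height_max G}. (\<Oplus>\<^bsub>real_mats N\<^esub>\<Omega>\<in>superlevel_components G a.
      kappa G \<beta> a \<Omega> \<cdot>\<^sub>m self_outer (indicator_vec N \<Omega>)) $$ (i, j))"
    unfolding solution_def index_finsum_mat[OF finite_atLeastAtMost_int level_sum_carrier assms, symmetric]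
    using carrier_matD[OF c] carrier_matD[OF outer_carrier(1)] assms by simp
  also have "\<dots> = q0 G \<beta> + (\<Sum>a\<in>{1..height_max G}. \<Sum>\<Omega>\<in>superlevel_components G a.
      (kappa G \<beta> a \<Omega> \<cdot>\<^sub>m self_outer (indicator_vec N \<Omega>)) $$ (i, j))"
    unfolding index_finsum_mat[OF finite_superlevel_components
        smult_carrier_mat[OF outer_carrier(2)] assms]
    using assms by (simp add: self_outer_def ones_vec_def)
  also have "\<dots> = q0 G \<beta> + (\<Sum>a\<in>{1..height_max G}. \<Sum>\<Omega>\<in>superlevel_components G a.
    kappa G \<beta> a \<Omega> * (of_bool (i \<in> \<Omega>) * of_bool (j \<in> \<Omega>)))"
    using assms by (intro arg_cong2[of _ _ _ _ "(+)"] refl sum.cong)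
      (simp add: self_outer_def indicator_vec_def)
  finally show ?thesis .
qed

lemma solution_sym: "transpose_mat solution = solution"
  by (rule eq_matI) (use carrier_matD[OF solution_carrier] in \<open>auto simp: solution_index mult.commute\<close>)

lemma sum_indicator:
  fixes x :: "nat \<Rightarrow> 'k::real_vector"
  assumes "\<Omega> \<in> superlevel_components G a"
  shows "(\<Sum>j<N. of_bool (j \<in> \<Omega>) *\<^sub>R x j) = sum x \<Omega>"
proof -
  have "(\<Sum>j<N. of_bool (j \<in> \<Omega>) *\<^sub>R x j) = (\<Sum>j<N. if j \<in> \<Omega> then x j else 0)"
    by (rule sum.cong) auto
  also have "\<dots> = sum x {j \<in> {..<N}. j \<in> \<Omega>}"
    by (rule sum.inter_filter[symmetric]) simp
  also have "{j \<in> {..<N}. j \<in> \<Omega>} = \<Omega>"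
    using superlevel_component_verts[OF assms] verts by auto
  finally show ?thesis .
qed

lemma sum_swap_components:
  "(\<Sum>j<N. \<Sum>a\<in>A. \<Sum>\<Omega>\<in>superlevel_components G a. f j a \<Omega>)
    = (\<Sum>a\<in>A. \<Sum>\<Omega>\<in>superlevel_components G a. \<Sum>j<N. f j a \<Omega>)"
  by (subst sum.swap, rule sum.cong[OF refl], rule sum.swap)

lemma act_solution_components:
  assumes v: "v < N"
  shows "act solution x v = q0 G \<beta> *\<^sub>R sum x (verts G)
    + (\<Sum>a\<in>{1..height_max G}. \<Sum>\<Omega>\<in>superlevel_components G a.
        (kappa G \<beta> a \<Omega> * of_bool (v \<in> \<Omega>)) *\<^sub>R sum x \<Omega>)"
proof -
  have "act solution x v = (\<Sum>j<N. q0 G \<beta> *\<^sub>R x j + (\<Sum>a\<in>{1..height_max G}.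
      \<Sum>\<Omega>\<in>superlevel_components G a.
        (kappa G \<beta> a \<Omega> * of_bool (v \<in> \<Omega>)) *\<^sub>R (of_bool (j \<in> \<Omega>) *\<^sub>R x j)))"
    unfolding act_def carrier_matD[OF solution_carrier]
  proof (rule sum.cong[OF refl])
    fix j assume "j \<in> {..<N}"
    then have j: "j < N" by simp
    show "solution $$ (v, j) *\<^sub>R x j = q0 G \<beta> *\<^sub>R x j + (\<Sum>a\<in>{1..height_max G}.
      \<Sum>\<Omega>\<in>superlevel_components G a.
        (kappa G \<beta> a \<Omega> * of_bool (v \<in> \<Omega>)) *\<^sub>R (of_bool (j \<in> \<Omega>) *\<^sub>R x j))"
      unfolding solution_index[OF v j] scaleR_left_distrib scaleR_sum_left
      by (simp only: scaleR_scaleR mult.assoc)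
  qed
  also have "\<dots> = q0 G \<beta> *\<^sub>R sum x (verts G) + (\<Sum>a\<in>{1..height_max G}.
      \<Sum>\<Omega>\<in>superlevel_components G a. \<Sum>j<N.
        (kappa G \<beta> a \<Omega> * of_bool (v \<in> \<Omega>)) *\<^sub>R (of_bool (j \<in> \<Omega>) *\<^sub>R x j))"
    unfolding sum.distrib sum_swap_components scaleR_sum_right verts ..
  also have "\<dots> = q0 G \<beta> *\<^sub>R sum x (verts G) + (\<Sum>a\<in>{1..height_max G}.
      \<Sum>\<Omega>\<in>superlevel_components G a. (kappa G \<beta> a \<Omega> * of_bool (v \<in> \<Omega>)) *\<^sub>R sum x \<Omega>)"
    by (intro arg_cong2[of _ _ _ _ "(+)"] refl sum.cong)
      (simp only: scaleR_sum_right[symmetric] sum_indicator)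
  finally show ?thesis .
qed

lemma act_solution:
  assumes v: "v < N"
  shows "act solution x v = cost_to_go \<beta> x v"
proof -
  have vG: "v \<in> verts G" using v by (simp add: verts)
  let ?t = "\<lambda>a. kappa G \<beta> a (level_component a v) *\<^sub>R sum x (level_component a v)"
  have level: "(\<Sum>\<Omega>\<in>superlevel_components G a. (kappa G \<beta> a \<Omega> * of_bool (v \<in> \<Omega>)) *\<^sub>R sum x \<Omega>)
      = (if a \<le> height G v then ?t a else 0)" for a
  proof -
    have "(\<Sum>\<Omega>\<in>superlevel_components G a. (kappa G \<beta> a \<Omega> * of_bool (v \<in> \<Omega>)) *\<^sub>R sum x \<Omega>)
        = (\<Sum>\<Omega>\<in>{\<Omega> \<in> superlevel_components G a. v \<in> \<Omega>}. kappa G \<beta> a \<Omega> *\<^sub>R sum x \<Omega>)"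
      unfolding sum.inter_filter[OF finite_superlevel_components]
      by (intro sum.cong refl) (simp add: of_bool_def)
    also have "{\<Omega> \<in> superlevel_components G a. v \<in> \<Omega>}
        = (if a \<le> height G v then {level_component a v} else {})"
      unfolding superlevel_components_eq
      using level_component_eq[of v a] level_component_self[of v a] level_component_subset[of a] vG
      by (auto simp: superlevel_def)
    finally show ?thesis by simp
  qed
  have "{a \<in> {1..height_max G}. a \<le> height G v} = {1..height G v}"
    using height_le_max[OF vG] by auto
  then have "(\<Sum>a\<in>{1..height_max G}. if a \<le> height G v then ?t a else 0) = sum ?t {1..height G v}"
    by (simp add: sum.inter_filter[symmetric])
  then show ?thesis
    unfolding act_solution_components[OF v] level cost_to_go_def by simp
qed

text \<open>
  The quadratic form of the solution is a weighted sum of the squared masses of the components.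
\<close>

lemma solution_psd: "psd_mat solution"
proof -
  have "0 \<le> x \<bullet> (solution *\<^sub>v x)" if x: "x \<in> carrier_vec N" for x
  proof -
    let ?x = "\<lambda>i. x $ i"
    have expand: "t * (q * X + (\<Sum>a\<in>A. \<Sum>\<Omega>\<in>B a. (k a \<Omega> * b \<Omega>) * M \<Omega>))
        = q * (X * t) + (\<Sum>a\<in>A. \<Sum>\<Omega>\<in>B a. (k a \<Omega> * M \<Omega>) * (b \<Omega> * t))"
      for t q X :: real and A :: "int set" and B :: "int \<Rightarrow> nat set set" and k b M
      by (simp add: distrib_left sum_distrib_left mult_ac)
    have "x \<bullet> (solution *\<^sub>v x) = (\<Sum>v<N. x $ v * (solution *\<^sub>v x) $ v)"
      unfolding scalar_prod_def using carrier_matD[OF solution_carrier]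
      by (simp add: atLeast0LessThan del: index_mult_mat_vec)
    also have "\<dots> = (\<Sum>v<N. q0 G \<beta> * (sum ?x (verts G) * x $ v) + (\<Sum>a\<in>{1..height_max G}.
        \<Sum>\<Omega>\<in>superlevel_components G a. (kappa G \<beta> a \<Omega> * sum ?x \<Omega>) * (of_bool (v \<in> \<Omega>) *\<^sub>R x $ v)))"
    proof (rule sum.cong[OF refl])
      fix v assume "v \<in> {..<N}"
      then have v: "v < N" by simp
      show "x $ v * (solution *\<^sub>v x) $ v = q0 G \<beta> * (sum ?x (verts G) * x $ v)
        + (\<Sum>a\<in>{1..height_max G}. \<Sum>\<Omega>\<in>superlevel_components G a.
          (kappa G \<beta> a \<Omega> * sum ?x \<Omega>) * (of_bool (v \<in> \<Omega>) *\<^sub>R x $ v))"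
        unfolding mult_mat_vec_eq_act[OF solution_carrier x v] act_solution_components[OF v]
          real_scaleR_def
        by (rule expand)
    qed
    also have "\<dots> = q0 G \<beta> * (sum ?x (verts G) * sum ?x (verts G)) + (\<Sum>a\<in>{1..height_max G}.
        \<Sum>\<Omega>\<in>superlevel_components G a. \<Sum>v<N. (kappa G \<beta> a \<Omega> * sum ?x \<Omega>) * (of_bool (v \<in> \<Omega>) *\<^sub>R x $ v))"
      unfolding sum.distrib sum_swap_components by (simp only: sum_distrib_left verts)
    also have "\<dots> = q0 G \<beta> * (sum ?x (verts G) * sum ?x (verts G)) + (\<Sum>a\<in>{1..height_max G}.
        \<Sum>\<Omega>\<in>superlevel_components G a. kappa G \<beta> a \<Omega> * (sum ?x \<Omega> * sum ?x \<Omega>))"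
      by (intro arg_cong2[of _ _ _ _ "(+)"] refl sum.cong)
        (simp only: sum_distrib_left[symmetric] sum_indicator mult.assoc)
    also have "\<dots> \<ge> 0"
    proof -
      obtain v where "v \<in> verts G" using verts_nonempty by blast
      then have "0 < q0 G \<beta>" by (rule q0_fixed_point(2)[OF \<beta>_pos \<beta>_less_1])
      moreover have "0 \<le> kappa G \<beta> a \<Omega>" if "\<Omega> \<in> superlevel_components G a" for a \<Omega>
        using that kappa_pos[OF \<beta>_pos] by (auto simp: superlevel_components_eq less_imp_le)
      ultimately show ?thesis
        by (intro add_nonneg_nonneg sum_nonneg mult_nonneg_nonneg[OF _ zero_le_square]) auto
    qed
    finally show ?thesis .
  qed
  then show ?thesis
    using solution_carrier solution_sym by (auto simp: psd_mat_def)
qed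

lemma verts_in_family_L: "verts G \<in> family_L G"
  by (simp add: family_L_def)

lemma superlevel_components_in_family_L:
  "1 \<le> a \<Longrightarrow> \<Omega> \<in> superlevel_components G a \<Longrightarrow> \<Omega> \<in> family_L G"
  using level_component_in_family_L by (auto simp: superlevel_components_eq)

lemma solution_in_space: "solution \<in> space_VL G"
proof -
  interpret V: matrix_vs N N "TYPE(real)" .
  let ?S = "(\<lambda>\<Omega>. self_outer (indicator_vec N \<Omega>)) ` family_L G"
  have S: "?S \<subseteq> carrier_mat N N" using outer_carrier by auto
  interpret W: LinearCombinations.submodule class_ring "V.span ?S" V.V
    by (rule V.span_is_submodule) (use S in simp)
  have span_carrier: "V.span ?S \<subseteq> carrier_mat N N"
    using V.span_is_subset2[of ?S] S by simp
  have mem: "self_outer (indicator_vec N \<Omega>) \<in> V.span ?S" if "\<Omega> \<in> family_L G" for \<Omega>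
    using V.in_own_span[of ?S] S that by auto
  have sum_mem: "finsum V.V f A \<in> V.span ?S" if "finite A" "\<And>a. a \<in> A \<Longrightarrow> f a \<in> V.span ?S"
    for f :: "'x \<Rightarrow> real mat" and A
    using that
  proof (induction A)
    case empty
    then show ?case using W.zero_closed by (simp add: module_mat_simps)
  next
    case (insert a A)
    then have "f \<in> A \<rightarrow> carrier_mat N N" "f a \<in> carrier_mat N N"
      using span_carrier by auto
    with insert show ?case using W.m_closed by (simp add: module_mat_simps)
  qed
  have "ones_vec N = indicator_vec N (verts G)"
    by (rule eq_vecI) (auto simp: ones_vec_def indicator_vec_def verts)
  then have "q0 G \<beta> \<cdot>\<^sub>m self_outer (ones_vec N) \<in> V.span ?S"
    using mem[OF verts_in_family_L] W.smult_closed by (simp add: module_mat_simps)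
  moreover have "(\<Oplus>\<^bsub>real_mats N\<^esub>a\<in>{1..height_max G}. \<Oplus>\<^bsub>real_mats N\<^esub>\<Omega>\<in>superlevel_components G a.
      kappa G \<beta> a \<Omega> \<cdot>\<^sub>m self_outer (indicator_vec N \<Omega>)) \<in> V.span ?S"
    using mem superlevel_components_in_family_L W.smult_closed
    by (intro sum_mem finite_superlevel_components) (auto simp: module_mat_simps)
  ultimately show ?thesis
    unfolding space_VL_def Let_def card_verts solution_def using W.m_closed by (simp add: module_mat_simps)
qed

end

section \<open>The explicit matrix solves the reduced DARE\<close>

context indexed_tree
begin

lemma D_carrier: "D_mat G \<beta> solution \<in> carrier_mat m m"
  and N_carrier: "N_mat G \<beta> solution \<in> carrier_mat N m"
  using D_N_mat_carrier[of solution G \<beta>] solution_carrier by (simp_all add: card_verts card_arcs)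

lemma act_solution_C:
  assumes v: "v < N"
  shows "act (solution * C_mat G) u v = cost_to_go \<beta> (\<lambda>v. inflow u v - outflow u v) v"
proof -
  have "act solution (act (C_mat G) u) v = act solution (\<lambda>v. inflow u v - outflow u v) v"
    by (rule act_cong) (use act_C carrier_matD[OF solution_carrier] in auto)
  then show ?thesis
    by (simp add: act_mult[OF solution_carrier carriers(3) v] act_solution[OF v])
qed

lemma act_D:
  assumes e: "e < m"
  shows "act (D_mat G \<beta> solution) u e = outflow u (tail G e)
    + \<beta> *\<^sub>R (cost_to_go \<beta> (\<lambda>v. inflow u v - outflow u v) (head G e)
      - cost_to_go \<beta> (\<lambda>v. inflow u v - outflow u v) (tail G e))"
proof -
  have St: "transpose_mat (sender_mat G) \<in> carrier_mat m N"
    and Ct: "transpose_mat (C_mat G) \<in> carrier_mat m N" using carriers by simp_all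
  have HC: "solution * C_mat G \<in> carrier_mat N m"
    by (rule mult_carrier_mat[OF solution_carrier carriers(3)])
  have 1: "act (transpose_mat (sender_mat G) * sender_mat G) u e = outflow u (tail G e)"
    by (simp add: act_mult[OF St carriers(1) e] act_sender_transpose[OF e] act_sender ends_less[OF e])
  have 2: "act (transpose_mat (C_mat G) * solution * C_mat G) u e
      = cost_to_go \<beta> (\<lambda>v. inflow u v - outflow u v) (head G e)
      - cost_to_go \<beta> (\<lambda>v. inflow u v - outflow u v) (tail G e)"
    by (simp add: assoc_mult_mat[OF Ct solution_carrier carriers(3)] act_mult[OF Ct HC e]
        act_C_transpose[OF e] act_solution_C ends_less[OF e])
  have c1: "transpose_mat (sender_mat G) * sender_mat G \<in> carrier_mat m m"
    by (rule mult_carrier_mat[OF St carriers(1)])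
  have c2: "transpose_mat (C_mat G) * solution * C_mat G \<in> carrier_mat m m"
    by (rule mult_carrier_mat[OF mult_carrier_mat[OF Ct solution_carrier] carriers(3)])
  show ?thesis
    unfolding D_mat_def act_add[OF c1 smult_carrier_mat[OF c2] e] act_smult[OF c2 e] 1 2 ..
qed

lemma act_N:
  assumes v: "v < N"
  shows "act (N_mat G \<beta> solution) u v
    = - outflow u v + \<beta> *\<^sub>R cost_to_go \<beta> (\<lambda>v. inflow u v - outflow u v) v"
proof -
  have HC: "solution * C_mat G \<in> carrier_mat N m"
    by (rule mult_carrier_mat[OF solution_carrier carriers(3)])
  have c: "- sender_mat G \<in> carrier_mat N m"
    using carriers(1) by simp
  show ?thesis
    unfolding N_mat_def act_add[OF c smult_carrier_mat[OF HC] v] act_smult[OF HC v]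
      act_uminus[OF carriers(1) v] act_sender[OF v] act_solution_C[OF v] ..
qed

lemma act_N_transpose:
  assumes e: "e < m"
  shows "act (transpose_mat (N_mat G \<beta> solution)) x e
    = - x (tail G e) + \<beta> *\<^sub>R (cost_to_go \<beta> x (head G e) - cost_to_go \<beta> x (tail G e))"
proof -
  have St: "transpose_mat (sender_mat G) \<in> carrier_mat m N"
    and Ct: "transpose_mat (C_mat G) \<in> carrier_mat m N" using carriers by simp_all
  have c1: "- transpose_mat (sender_mat G) \<in> carrier_mat m N" using St by simp
  have c2: "transpose_mat (C_mat G) * solution \<in> carrier_mat m N"
    by (rule mult_carrier_mat[OF Ct solution_carrier])
  show ?thesis
    unfolding N_mat_def transpose_cross_term[OF carriers(1,3) solution_carrier solution_sym]
      act_add[OF c1 smult_carrier_mat[OF c2] e] act_smult[OF c2 e] act_uminus[OF St e]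
      act_sender_transpose[OF e] act_mult[OF Ct solution_carrier e] act_C_transpose[OF e]
    by (simp add: act_solution ends_less[OF e])
qed

text \<open>
  A flow in the kernel of \<open>D\<close> is stationary for the zero state, hence zero.
\<close>

lemma D_invertible: "invertible_mat (D_mat G \<beta> solution)"
proof -
  let ?D = "D_mat G \<beta> solution"
  have "det ?D \<noteq> 0"
  proof
    assume "det ?D = 0"
    then obtain w where w: "w \<in> carrier_vec m" "w \<noteq> 0\<^sub>v m" "?D *\<^sub>v w = 0\<^sub>v m"
      using det_0_iff_vec_prod_zero_field[OF D_carrier] by blast
    define u where "u e = w $ e" for e
    interpret stationary_flow G \<beta> "\<lambda>_. 0" "\<lambda>v. 0 - outflow u v" "\<lambda>v. 0 - outflow u v + inflow u v" u
    proof unfold_locales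
      fix e assume "e \<in> arcs G"
      then have e: "e < m" by (simp add: arcs)
      have "act ?D u e = 0"
        using mult_mat_vec_eq_act[OF D_carrier w(1) e] w(3) e by (simp add: u_def[abs_def])
      then show "0 - outflow u (tail G e)
          = \<beta> *\<^sub>R (cost_to_go \<beta> (\<lambda>v. 0 - outflow u v + inflow u v) (head G e)
            - cost_to_go \<beta> (\<lambda>v. 0 - outflow u v + inflow u v) (tail G e))"
        unfolding act_D[OF e] by (simp add: eq_neg_iff_add_eq_0 add.commute)
    qed (use \<beta>_pos in simp_all)
    have "w $ e = 0" if "e < m" for e
      using flow_zero_of_state_zero[of e] that by (simp add: arcs u_def)
    with w(1,2) show False by (metis eq_vecI carrier_vecD index_zero_vec)
  qed
  then have "?D \<in> Units (ring_mat TYPE(real) m ())"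
    by (rule det_non_zero_imp_unit[OF D_carrier])
  then obtain B where "B \<in> carrier_mat m m" "B * ?D = 1\<^sub>m m" "?D * B = 1\<^sub>m m"
    by (auto simp: Units_def ring_mat_simps)
  then show ?thesis
    using D_carrier by (auto simp: invertible_mat_def inverts_mat_def intro!: exI[of _ B])
qed

abbreviation feedback :: "real mat" where
  "feedback \<equiv> feedback_mat G \<beta> solution"

lemmas feedback_facts =
  feedback_mat[OF _ D_invertible, unfolded card_verts card_arcs, OF solution_carrier]

text \<open>
  The flow \<open>u = - F x\<close> chosen by the feedback satisfies \<open>D u + N\<^sup>T x = 0\<close>, which read edge by edge is
  stationarity.
\<close>

lemma feedback_flow_stationary:
  fixes x :: "nat \<Rightarrow> 'k::real_vector"
  defines "u \<equiv> \<lambda>e. - act feedback x e"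
  shows "stationary_flow G \<beta> x (\<lambda>v. x v - outflow u v) (\<lambda>v. x v - outflow u v + inflow u v) u"
proof unfold_locales
  let ?w = "\<lambda>v. inflow u v - outflow u v"
  fix e assume "e \<in> arcs G"
  then have e: "e < m" by (simp add: arcs)
  have "act (D_mat G \<beta> solution) u e = - act (transpose_mat (N_mat G \<beta> solution)) x e"
    unfolding u_def act_fun_uminus act_mult[OF D_carrier feedback_facts(1) e, symmetric]
      feedback_facts(2) ..
  then have "outflow u (tail G e) + \<beta> *\<^sub>R (cost_to_go \<beta> ?w (head G e) - cost_to_go \<beta> ?w (tail G e))
      = x (tail G e) - \<beta> *\<^sub>R (cost_to_go \<beta> x (head G e) - cost_to_go \<beta> x (tail G e))"
    unfolding act_D[OF e] act_N_transpose[OF e] by simp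
  moreover have "(\<lambda>v. x v - outflow u v + inflow u v) = (\<lambda>v. x v + ?w v)"
    by auto
  ultimately show "x (tail G e) - outflow u (tail G e)
      = \<beta> *\<^sub>R (cost_to_go \<beta> (\<lambda>v. x v - outflow u v + inflow u v) (head G e)
        - cost_to_go \<beta> (\<lambda>v. x v - outflow u v + inflow u v) (tail G e))"
    by (simp only: cost_to_go_add) (simp add: algebra_simps)
qed (use \<beta>_pos in simp_all)

text \<open>
  Applied to a state \<open>x\<close>, the DARE is the Bellman equation of the flow \<open>- F x\<close>.
\<close>

lemma solution_dare: "reduced_dare_solution G \<beta> solution"
proof -
  have NF: "N_mat G \<beta> solution * feedback \<in> carrier_mat N N"
    by (rule mult_carrier_mat[OF N_carrier feedback_facts(1)])
  have bH: "\<beta> \<cdot>\<^sub>m solution \<in> carrier_mat N N" using solution_carrier by simp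
  have sum: "1\<^sub>m N + \<beta> \<cdot>\<^sub>m solution \<in> carrier_mat N N" using bH by simp
  have "solution = 1\<^sub>m N + \<beta> \<cdot>\<^sub>m solution - N_mat G \<beta> solution * feedback"
  proof (rule mat_eq_of_act_eq[OF solution_carrier minus_carrier_mat[OF NF]])
    fix x :: "nat \<Rightarrow> real" and v assume v: "v < N"
    define u where "u e = - act feedback x e" for e
    let ?w = "\<lambda>v. inflow u v - outflow u v"
    interpret stationary_flow G \<beta> x "\<lambda>v. x v - outflow u v" "\<lambda>v. x v - outflow u v + inflow u v" u
      unfolding u_def by (rule feedback_flow_stationary)
    have "act (N_mat G \<beta> solution) u v = - act (N_mat G \<beta> solution * feedback) x v"
      unfolding u_def act_fun_uminus act_mult[OF N_carrier feedback_facts(1) v] ..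
    then have N: "act (N_mat G \<beta> solution * feedback) x v
        = outflow u v - \<beta> *\<^sub>R cost_to_go \<beta> ?w v"
      unfolding act_N[OF v] by simp
    have step: "(\<lambda>v. x v - outflow u v + inflow u v) = (\<lambda>v. x v + ?w v)"
      by auto
    have "v \<in> verts G" using v by (simp add: verts)
    from bellman_equation[OF \<beta>_less_1 this]
    have "cost_to_go \<beta> x v = x v - outflow u v + \<beta> *\<^sub>R (cost_to_go \<beta> x v + cost_to_go \<beta> ?w v)"
      unfolding step cost_to_go_add .
    also have "\<dots> = x v + \<beta> *\<^sub>R cost_to_go \<beta> x v - (outflow u v - \<beta> *\<^sub>R cost_to_go \<beta> ?w v)"
      by (simp add: algebra_simps)
    finally show "act solution x v
        = act (1\<^sub>m N + \<beta> \<cdot>\<^sub>m solution - N_mat G \<beta> solution * feedback) x v"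
      unfolding act_minus[OF sum NF v] act_add[OF one_carrier_mat bH v] act_one[OF v]
        act_smult[OF solution_carrier v] act_solution[OF v] N .
  qed
  then show ?thesis
    unfolding reduced_dare_solution_def Let_def card_verts feedback_facts(3)
    by (intro conjI solution_carrier solution_sym D_invertible)
qed

text \<open>
  An eigenvalue \<open>z\<close> with \<open>\<bar>z\<bar> \<ge> 1\<close> would give the unscaled closed loop the eigenvalue \<open>z / \<surd>\<beta>\<close> of
  modulus above one, which is neither \<open>0\<close> nor \<open>1\<close>.
\<close>

lemma solution_stabilizing: "stabilizing G \<beta> solution"
  unfolding stabilizing_def
proof (intro allI impI)
  fix z assume "eigenvalue (map_mat complex_of_real (closed_loop_mat G \<beta> solution)) z"
  moreover have CF: "C_mat G * feedback \<in> carrier_mat N N"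
    by (rule mult_carrier_mat[OF carriers(3) feedback_facts(1)])
  have M: "1\<^sub>m N - C_mat G * feedback \<in> carrier_mat N N"
    by (rule minus_carrier_mat[OF CF])
  have cl: "closed_loop_mat G \<beta> solution = sqrt \<beta> \<cdot>\<^sub>m (1\<^sub>m N - C_mat G * feedback)"
    by (rule feedback_facts(4))
  then have cl_carrier: "closed_loop_mat G \<beta> solution \<in> carrier_mat N N" using M by simp
  ultimately obtain w where w: "w \<in> carrier_vec N" "w \<noteq> 0\<^sub>v N"
    "map_mat complex_of_real (closed_loop_mat G \<beta> solution) *\<^sub>v w = z \<cdot>\<^sub>v w"
    by (auto simp: eigenvalue_def eigenvector_def)
  define x where "x v = w $ v" for v
  define u where "u e = - act feedback x e" for e
  have sq: "0 < sqrt \<beta>" "sqrt \<beta> < 1" using \<beta>_pos \<beta>_less_1 by simp_all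
  define \<mu> where "\<mu> = z / complex_of_real (sqrt \<beta>)"
  show "cmod z < 1"
  proof (rule ccontr)
    assume "\<not> cmod z < 1"
    then have "sqrt \<beta> < cmod z" using sq by linarith
    then have "1 < cmod \<mu>" using sq by (simp add: \<mu>_def norm_divide)
    then have \<mu>: "\<mu> \<noteq> 0" "\<mu> \<noteq> 1" by auto
    interpret f: stationary_flow G \<beta> x "\<lambda>v. x v - outflow u v" "\<lambda>v. x v - outflow u v + inflow u v" u
      unfolding u_def by (rule feedback_flow_stationary)
    have eigen: "x v - outflow u v + inflow u v = \<mu> * x v" if "v \<in> verts G" for v
    proof -
      from that have v: "v < N" by (simp add: verts)
      have "z * x v = act (closed_loop_mat G \<beta> solution) x v"
        using complex_mult_mat_vec_eq_act[OF cl_carrier w(1) v] w(1,3) v by (simp add: x_def[abs_def])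
      also have "\<dots> = sqrt \<beta> *\<^sub>R (x v - act (C_mat G) (act feedback x) v)"
        unfolding cl act_smult[OF M v] act_minus[OF one_carrier_mat CF v] act_one[OF v]
          act_mult[OF carriers(3) feedback_facts(1) v] ..
      also have "act (C_mat G) (act feedback x) v = - act (C_mat G) u v"
        by (simp add: u_def[abs_def] act_fun_uminus)
      also have "\<dots> = - (inflow u v - outflow u v)"
        by (simp add: act_C[OF v])
      finally have "z * x v = sqrt \<beta> *\<^sub>R (x v - outflow u v + inflow u v)"
        by simp
      then show ?thesis
        using sq by (simp add: \<mu>_def scaleR_conv_of_real field_simps)
    qed
    interpret stationary_eigenflow G \<beta> x "\<lambda>v. x v - outflow u v" "\<lambda>v. x v - outflow u v + inflow u v" u \<mu>
      by unfold_locales (use eigen \<mu> in auto)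
    have "w $ v = 0" if "v < N" for v
      using state_zero[of v] that by (simp add: verts x_def)
    with w(1,2) show False by (metis eq_vecI carrier_vecD index_zero_vec)
  qed
qed

lemma stabilizing_psd_solution_iff: "stabilizing_psd_solution G \<beta> H \<longleftrightarrow> H = solution"
proof
  assume "stabilizing_psd_solution G \<beta> H"
  then show "H = solution"
    unfolding stabilizing_psd_solution_def
    by (intro stabilizing_solution_unique[OF \<beta>_pos _ _ solution_dare solution_stabilizing]) blast+
next
  assume "H = solution"
  then show "stabilizing_psd_solution G \<beta> H"
    unfolding stabilizing_psd_solution_def
    using solution_dare solution_stabilizing solution_psd by blast
qed

end

theorem theorem2:
  fixes G :: "(nat, nat) pre_digraph" and N m :: nat and \<beta> :: real
  assumes "directed_tree G"
    and "verts G = {..<N}" and "arcs G = {..<m}"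
    and "0 < \<beta>" and "\<beta> < 1"
  shows "(\<exists>!H. stabilizing_psd_solution G \<beta> H)
    \<and> (\<forall>H. stabilizing_psd_solution G \<beta> H \<longrightarrow>
         H = q0 G \<beta> \<cdot>\<^sub>m self_outer (ones_vec N)
             + (\<Oplus>\<^bsub>real_mats N\<^esub>a\<in>{1..height_max G}.
                 \<Oplus>\<^bsub>real_mats N\<^esub>\<Omega>\<in>superlevel_components G a.
                   kappa G \<beta> a \<Omega> \<cdot>\<^sub>m self_outer (indicator_vec N \<Omega>))
         \<and> H \<in> space_VL G)
    \<and> verts G \<in> family_L G
    \<and> (\<forall>a\<in>{1..height_max G}. \<forall>\<Omega>\<in>superlevel_components G a. \<Omega> \<in> family_L G)
    \<and> q0 G \<beta> > 0
    \<and> (\<forall>a\<in>{1..height_max G}. \<forall>\<Omega>\<in>superlevel_components G a. kappa G \<beta> a \<Omega> > 0)"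
proof -
  interpret fin_digraph G
    using assms(1) by (simp add: directed_tree_def)
  interpret indexed_tree G N m \<beta>
    by unfold_locales (fact assms)+
  obtain v where v: "v \<in> verts G" using verts_nonempty by blast
  show ?thesis
    unfolding stabilizing_psd_solution_iff
  proof (intro conjI ballI allI impI)
    show "\<exists>!H. H = solution" by blast
    show "H = q0 G \<beta> \<cdot>\<^sub>m self_outer (ones_vec N)
             + (\<Oplus>\<^bsub>real_mats N\<^esub>a\<in>{1..height_max G}.
                 \<Oplus>\<^bsub>real_mats N\<^esub>\<Omega>\<in>superlevel_components G a.
                   kappa G \<beta> a \<Omega> \<cdot>\<^sub>m self_outer (indicator_vec N \<Omega>))" if "H = solution" for H
      unfolding that by (rule solution_def)
    show "H \<in> space_VL G" if "H = solution" for H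
      unfolding that by (rule solution_in_space)
    show "verts G \<in> family_L G" by (rule verts_in_family_L)
    show "\<Omega> \<in> family_L G" if "a \<in> {1..height_max G}" "\<Omega> \<in> superlevel_components G a" for a \<Omega>
      by (rule superlevel_components_in_family_L[OF _ that(2)]) (use that(1) in simp)
    show "0 < q0 G \<beta>" by (rule q0_fixed_point(2)[OF assms(4,5) v])
    show "0 < kappa G \<beta> a \<Omega>" if "a \<in> {1..height_max G}" "\<Omega> \<in> superlevel_components G a" for a \<Omega>
      using that(2) kappa_pos[OF assms(4)] by (auto simp: superlevel_components_eq)
  qed
qed

end
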